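(* For every positive integer $n$, the following hold (with $d$ a constant dimension in (iv) and (v)): (i) There exist $n$ tetrahedra in $\mathbb{R}^3$ such that any 3-hop spanner of their intersection graph requires $\Omega(n^{4/3})$ edges. (ii) There exist $n$ congruent regular tetrahedra in $\mathbb{R}^3$ such that any 2-hop spanner of their intersection graph requires $\Omega(n^{4/3})$ edges; the same holds with $n$ congruent (non-axis-aligned) cubes in $\mathbb{R}^3$ in place of regular tetrahedra. (iii) There exist $n$ congruent balls in $\mathbb{R}^5$ such that any 2-hop spanner of their intersection graph requires $\Omega(n^{4/3})$ edges. (iv) There exist $n$ axis-aligned boxes in $\mathbb{R}^d$ such that any 3-hop spanner of their intersection graph requires $\Omega\!\left(n\left(\frac{\log n}{\log\log n}\right)^{d-2}\right)$ edges. (v) There exist $n$ congruent axis-aligned hypercubes in $\mathbb{R}^d$ such that any 2-hop spanner of their intersection graph requires $\Omega\!\left(n\left(\frac{\log n}{\log\log n}\right)^{\lfloor d/2\rfloor-1}\right)$ edges.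
   Context: The intersection graph of a family of sets has one vertex per set and an (unweighted) edge between two distinct sets iff they have nonempty intersection. For a simple graph $G=(V,E)$, a $t$-hop spanner is a spanning subgraph $G'=(V,E')$, $E'\subseteq E$, with $d_{G'}(x,y)\le t\cdot d_G(x,y)$ for all $x,y\in V$, where $d_G$ is the shortest-path (hop) distance. Tetrahedra, cubes, boxes and balls are solid bodies. The $\Omega(\cdot)$ notation is asymptotic as $n\to\infty$, with constants that may depend on $d$ only. *)

theory Defs
  imports "HOL-Analysis.Analysis" "HOL-Library.Landau_Symbols" "HOL-Library.Extended_Nat"
begin

text \<open>
  A simple graph is given by a vertex set and a set of edges, each edge being a
  two-element set of vertices.
\<close>

definition intersection_edges :: "'a set set \<Rightarrow> 'a set set set" where
  "intersection_edges F = {{A, B} |A B. A \<in> F \<and> B \<in> F \<and> A \<noteq> B \<and> A \<inter> B \<noteq> {}}"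

definition adjacency :: "'v set set \<Rightarrow> ('v \<times> 'v) set" where
  "adjacency E = {(x, y). {x, y} \<in> E}"

text \<open>
  The least length of a walk; it is \<open>\<infinity>\<close> (the infimum of the empty set) if there is none.
\<close>

definition hop_dist :: "'v set set \<Rightarrow> 'v \<Rightarrow> 'v \<Rightarrow> enat" where
  "hop_dist E x y = Inf {enat k |k. (x, y) \<in> adjacency E ^^ k}"

definition hop_spanner :: "nat \<Rightarrow> 'v set \<Rightarrow> 'v set set \<Rightarrow> 'v set set \<Rightarrow> bool" where
  "hop_spanner t V E E' \<longleftrightarrow>
     E' \<subseteq> E \<and> (\<forall>x\<in>V. \<forall>y\<in>V. hop_dist E' x y \<le> enat t * hop_dist E x y)"

text \<open>
  Used with \<open>m = f n\<close> for some \<open>f \<in> \<Omega>(g)\<close>.  The bound \<open>m\<close> has type \<^typ>\<open>nat\<close>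
  because the Landau symbol \<open>\<Omega>\<close> only constrains absolute values: with a negative \<open>f\<close>
  the asymptotic lower bound would be void.
\<close>

definition spanners_require :: "nat \<Rightarrow> 'a set set \<Rightarrow> nat \<Rightarrow> bool" where
  "spanners_require t F m \<longleftrightarrow>
     (\<forall>E'. hop_spanner t F (intersection_edges F) E' \<longrightarrow> m \<le> card E')"

definition congruent_sets :: "'a::metric_space set \<Rightarrow> 'a set \<Rightarrow> bool" where
  "congruent_sets S T \<longleftrightarrow> (\<exists>h. (\<forall>x y. dist (h x) (h y) = dist x y) \<and> h ` S = T)"

definition tetrahedron :: "(real^3) set \<Rightarrow> bool" where
  "tetrahedron T \<longleftrightarrow> 3 simplex T"

definition regular_tetrahedron :: "(real^3) set \<Rightarrow> bool" where
  "regular_tetrahedron T \<longleftrightarrow>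
     (\<exists>C s. \<not> affine_dependent C \<and> card C = 4 \<and> T = convex hull C \<and>
        (\<forall>x\<in>C. \<forall>y\<in>C. x \<noteq> y \<longrightarrow> dist x y = s))"

definition solid_ball :: "(real^'d) set \<Rightarrow> bool" where
  "solid_ball B \<longleftrightarrow> (\<exists>x r. 0 < r \<and> B = cball x r)"

definition axis_aligned_box :: "(real^'d) set \<Rightarrow> bool" where
  "axis_aligned_box B \<longleftrightarrow> (\<exists>a b. (\<forall>i. a $ i < b $ i) \<and> B = cbox a b)"

definition axis_aligned_hypercube :: "(real^'d) set \<Rightarrow> bool" where
  "axis_aligned_hypercube Q \<longleftrightarrow> (\<exists>a s. 0 < s \<and> Q = cbox a (\<chi> i. a $ i + s))"

text \<open>A hypercube in arbitrary position.\<close>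

definition hypercube :: "(real^'d) set \<Rightarrow> bool" where
  "hypercube Q \<longleftrightarrow> (\<exists>Q0. axis_aligned_hypercube Q0 \<and> congruent_sets Q0 Q)"

end

theory Submission
  imports Defs "HOL-Number_Theory.Cong" "HOL-Real_Asymp.Real_Asymp"
begin

text \<open>
  All bounds come from families \<open>A\<close>, \<open>B\<close> of bodies whose incidence graph (\<open>a \<in> A\<close> meets \<open>b \<in> B\<close>)
  contains no \<open>K\<^sub>2\<^sub>,\<^sub>2\<close> but has many edges. If the members of \<open>A\<close> are pairwise disjoint, and those of \<open>B\<close>
  too, a 3-hop spanner must contain every incidence. For a 2-hop spanner no disjointness is needed:
  an edge inside \<open>A\<close> or \<open>B\<close> bridges at most two incidences, since its ends have at most one common
  neighbour on the other side.

  For \<open>n powr (4/3)\<close> the incidences are those of points and lines in a planar grid. Lines placed at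
  distinct heights and vertical segments over the points are thickened to tetrahedra; congruent solids
  stand on the plane \<open>z = 0\<close> with a vertex at each point and hang below it with an edge along each line;
  balls in dimension five use a lifting of \<open>(b - m a - c)\<^sup>2\<close>.

  For axis-parallel bodies the incidences are those of a Halton-type point set: the coordinates of
  \<open>m\<close> are its digit reversals in pairwise coprime bases \<open>q\<^sub>j\<close> of nearly equal size \<open>q\<close>, and the boxes are
  the residue classes modulo \<open>\<Prod>\<^sub>j q\<^sub>j ^ e\<^sub>j\<close> with \<open>\<Sum>\<^sub>j e\<^sub>j = t - 1\<close>. Two points sharing boxes of
  different shapes agree modulo a product of \<open>t\<close> bases, hence coincide, while each point lies in one box
  of every shape.
\<close>

section \<open>Spanners and incidences\<close>

text \<open>In the box construction the base size \<open>q\<close> is under two opposing demands.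
  About \<open>s^(D-1)\<close> shapes with about \<open>q^(t-1)\<close> boxes each may use only half
  of the budget \<open>n\<close>, which is roughly \<open>q^t\<close>; so \<open>q\<close> must
  exceed a multiple of \<open>s^(D-1)\<close>. As \<open>t\<close> is about \<open>D * s\<close>,
  this leaves \<open>s\<close> of order \<open>ln n / ln (ln n)\<close>, and every point has
  \<open>s^(D-1)\<close> incidences. If the bases were far apart, some shapes would have too many
  boxes, or a product of \<open>t\<close> small bases would fail to reach \<open>n\<close> and two
  boxes would not determine a point. The exponents reflect the number \<open>D\<close> of usable
  coordinates. Disjointness costs one coordinate, so boxes have \<open>D = d - 1\<close>. Cubes of a
  fixed large side can test only one end of an interval in each coordinate, so congruent cubes spend
  two coordinates on an interval and \<open>D\<close> is the floor of \<open>d / 2\<close>. For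
  \<open>D = 0\<close> the exponent is \<open>-1\<close>, and disjoint pairs of meeting cubes
  suffice. Axis-parallel bodies and balls come from integer data, whose gap of one pays for shifts
  and error terms.\<close>

definition K22_free :: "('a \<Rightarrow> 'b \<Rightarrow> bool) \<Rightarrow> 'a set \<Rightarrow> 'b set \<Rightarrow> bool" where
  "K22_free R A B \<longleftrightarrow> (\<forall>a\<in>A. \<forall>a'\<in>A. \<forall>b\<in>B. \<forall>b'\<in>B.
     R a b \<and> R a b' \<and> R a' b \<and> R a' b' \<longrightarrow> a = a' \<or> b = b')"

definition incidences :: "('a \<Rightarrow> 'b \<Rightarrow> bool) \<Rightarrow> 'a set \<Rightarrow> 'b set \<Rightarrow> ('a \<times> 'b) set" where
  "incidences R A B = {(a, b). a \<in> A \<and> b \<in> B \<and> R a b}"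

abbreviation meets :: "'a set \<Rightarrow> 'a set \<Rightarrow> bool" where
  "meets S T \<equiv> S \<inter> T \<noteq> {}"

lemma finite_incidences [simp]: "finite A \<Longrightarrow> finite B \<Longrightarrow> finite (incidences R A B)"
  by (rule finite_subset[of _ "A \<times> B"]) (auto simp: incidences_def)

lemma finite_intersection_edges [simp]: "finite F \<Longrightarrow> finite (intersection_edges F)"
  by (rule finite_subset[of _ "Pow F"]) (auto simp: intersection_edges_def)

lemma intersection_edge_iff:
  "{x, y} \<in> intersection_edges F \<longleftrightarrow> x \<in> F \<and> y \<in> F \<and> x \<noteq> y \<and> meets x y"
  unfolding intersection_edges_def by (auto simp: doubleton_eq_iff)

text \<open>Spanners are tested on single edges only. The stretched distance of an edge is at most
  \<open>t\<close>, and an infimum in \<open>enat\<close> with this property comes from an actual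
  walk: otherwise all walk lengths would be at least \<open>Suc t\<close>.\<close>

lemma hop_spanner_edge:
  assumes "hop_spanner t V E E'" "x \<in> V" "y \<in> V" "{x, y} \<in> E"
  obtains k where "k \<le> t" "(x, y) \<in> adjacency E' ^^ k"
proof -
  have "(x, y) \<in> adjacency E ^^ 1" using assms by (simp add: adjacency_def)
  hence "hop_dist E x y \<le> enat 1"
    unfolding hop_dist_def by (intro Inf_lower) blast
  hence "enat t * hop_dist E x y \<le> enat t * enat 1"
    by (intro mult_left_mono) auto
  hence le: "hop_dist E' x y \<le> enat t"
    using assms unfolding hop_spanner_def by (metis order_trans mult.right_neutral one_enat_def)
  show ?thesis
  proof (rule ccontr)
    assume "\<not> thesis"
    hence "\<And>k. (x, y) \<in> adjacency E' ^^ k \<Longrightarrow> Suc t \<le> k"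
      using that not_less_eq_eq by blast
    hence "enat (Suc t) \<le> hop_dist E' x y"
      unfolding hop_dist_def by (auto simp: le_Inf_iff)
    from order_trans[OF this le] show False by simp
  qed
qed

lemma hop_spanner_mono:
  assumes "hop_spanner s V E E'" "s \<le> t"
  shows "hop_spanner t V E E'"
  using assms unfolding hop_spanner_def
  by (meson enat_ord_simps(1) mult_right_mono order_trans zero_le)

lemma spanners_require_antimono:
  "spanners_require t F m \<Longrightarrow> s \<le> t \<Longrightarrow> k \<le> m \<Longrightarrow> spanners_require s F k"
  unfolding spanners_require_def using hop_spanner_mono order_trans by blast

lemma spanners_require_0 [simp]: "spanners_require t F 0"
  by (simp add: spanners_require_def)

text \<open>Double counting: every incidence is charged to some edge of the spanner, and no edge is
  charged more than twice. The bound is half the number of incidences, rounded up.\<close>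

lemma spanners_require_2_families:
  fixes A B :: "'a set set"
  assumes fin: "finite A" "finite B" and disj: "A \<inter> B = {}" and K: "K22_free meets A B"
  shows "spanners_require 2 (A \<union> B) ((card (incidences meets A B) + 1) div 2)"
  unfolding spanners_require_def
proof (intro allI impI)
  fix E' assume sp: "hop_spanner 2 (A \<union> B) (intersection_edges (A \<union> B)) E'"
  let ?I = "incidences meets A B"
  have E': "E' \<subseteq> intersection_edges (A \<union> B)" using sp by (simp add: hop_spanner_def)
  have finE': "finite E'" using E' fin finite_subset by (metis finite_UnI finite_intersection_edges)
  \<comment> \<open>\<open>C e\<close> holds the incidences charged to \<open>e\<close>: the
    incidence \<open>e\<close> itself, or those with a detour \<open>a\<close>, \<open>x\<close>,
    \<open>b\<close> whose edge inside one family is \<open>e\<close>. Since \<open>x\<close> lies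
    in \<open>A\<close> or in \<open>B\<close>, exactly one edge of a detour stays inside a
    family.\<close>
  define C where "C e = {(a, b). (a, b) \<in> ?I \<and> (e = {a, b} \<or>
     (\<exists>x\<in>A. x \<noteq> a \<and> e = {a, x} \<and> meets x b) \<or> (\<exists>x\<in>B. x \<noteq> b \<and> e = {x, b} \<and> meets a x))}" for e
  have "?I \<subseteq> (\<Union>e\<in>E'. C e)"
  proof
    fix p assume "p \<in> ?I"
    then obtain a b where p: "p = (a, b)" and ab: "a \<in> A" "b \<in> B" "meets a b"
      by (auto simp: incidences_def)
    have ne: "a \<noteq> b" using ab disj by auto
    have "{a, b} \<in> intersection_edges (A \<union> B)"
      unfolding intersection_edge_iff using ab ne by blast
    then obtain k where k: "k \<le> 2" "(a, b) \<in> adjacency E' ^^ k"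
      using hop_spanner_edge[OF sp, of a b] ab(1,2) by blast
    have "k \<noteq> 0" using k ne by (cases k) auto
    then consider "k = 1" | "k = Suc (Suc 0)" using k by linarith
    then show "p \<in> (\<Union>e\<in>E'. C e)"
    proof cases
      case 1
      then show ?thesis using k \<open>p \<in> ?I\<close> by (auto simp: adjacency_def C_def p)
    next
      case 2
      then obtain x where x: "{a, x} \<in> E'" "{x, b} \<in> E'"
        using k by (auto simp: adjacency_def)
      hence m: "x \<in> A \<union> B" "x \<noteq> a" "x \<noteq> b" "meets a x" "meets x b"
        using E' intersection_edge_iff[of _ _ "A \<union> B"] by blast+
      show ?thesis
      proof (cases "x \<in> A")
        case True
        hence "p \<in> C {a, x}" using m \<open>p \<in> ?I\<close> unfolding C_def p by blast
        thus ?thesis using x by blast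
      next
        case False
        hence "p \<in> C {x, b}" using m \<open>p \<in> ?I\<close> unfolding C_def p by blast
        thus ?thesis using x by blast
      qed
    qed
  qed
  moreover have finC: "finite (C e)" for e
    by (rule finite_subset[of _ ?I]) (use fin in \<open>auto simp: C_def\<close>)
  ultimately have "card ?I \<le> card (\<Union>e\<in>E'. C e)"
    using finE' by (intro card_mono) auto
  also have "\<dots> \<le> (\<Sum>e\<in>E'. card (C e))" by (rule card_UN_le[OF finE'])
  also have "\<dots> \<le> (\<Sum>e\<in>E'. 2)"
  proof (rule sum_mono)
    fix e assume "e \<in> E'"
    have two: "card (C e) \<le> 2" if "C e \<subseteq> {p, q}" for p q
      using card_mono[OF _ that] card_insert_le_m1[of 2 "{q}" p] by simp
    show "card (C e) \<le> 2"
    proof (cases "C e = {}")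
      case False
      then obtain a b where ab: "(a, b) \<in> C e" by auto
      hence I: "a \<in> A" "b \<in> B" "meets a b" by (auto simp: C_def incidences_def)
      from ab consider "e = {a, b}" | x where "x \<in> A" "x \<noteq> a" "e = {a, x}" "meets x b"
        | x where "x \<in> B" "x \<noteq> b" "e = {x, b}" "meets a x"
        by (auto simp: C_def)
      then show ?thesis
      proof cases
        case 1
        have "C e \<subseteq> {(a, b), (a, b)}"
        proof
          fix p assume "p \<in> C e"
          then obtain a' b' where p: "p = (a', b')" and "(a', b') \<in> C e" by (cases p) simp
          then have p: "p = (a', b')" "a' \<in> A" "b' \<in> B" "meets a' b'"
            and "e = {a', b'} \<or> (\<exists>y\<in>A. y \<noteq> a' \<and> e = {a', y} \<and> meets y b')
              \<or> (\<exists>y\<in>B. y \<noteq> b' \<and> e = {y, b'} \<and> meets a' y)"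
            unfolding C_def incidences_def by simp_all
          \<comment> \<open>A crossing edge lies inside neither family, which rules out both detour
            clauses.\<close>
          moreover have "\<not> e \<subseteq> A" "\<not> e \<subseteq> B" using I(1,2) disj unfolding 1 by blast+
          ultimately have "e = {a', b'}" using p(2,3) by (metis empty_subsetI insert_subset)
          then have "a = a' \<and> b = b' \<or> a = b' \<and> b = a'" by (simp only: 1 doubleton_eq_iff)
          moreover have "a \<noteq> b'" using I(1) p(3) disj by blast
          ultimately have "a' = a \<and> b' = b" by blast
          then show "p \<in> {(a, b), (a, b)}" by (simp add: p)
        qed
        thus ?thesis by (rule two)
      next
        case (2 x)
        \<comment> \<open>With \<open>a\<close> and \<open>x\<close> fixed, \<open>K22_free\<close>
          leaves a single common neighbour \<open>b\<close>, so the edge can serve only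
          \<open>(a, b)\<close> and \<open>(x, b)\<close>.\<close>
        have u: "b' = b" if "b' \<in> B" "meets a b'" "meets x b'" for b'
          using K that 2(1,2,4) I unfolding K22_free_def by metis
        have "C e \<subseteq> {(a, b), (x, b)}"
        proof
          fix p assume "p \<in> C e"
          then obtain a' b' where p: "p = (a', b')" and "(a', b') \<in> C e" by (cases p) simp
          then have p: "p = (a', b')" "a' \<in> A" "b' \<in> B" "meets a' b'"
            and "e = {a', b'} \<or> (\<exists>y\<in>A. y \<noteq> a' \<and> e = {a', y} \<and> meets y b')
              \<or> (\<exists>y\<in>B. y \<noteq> b' \<and> e = {y, b'} \<and> meets a' y)"
            unfolding C_def incidences_def by simp_all
          moreover have "b' \<notin> e" using p(3) I(1) disj 2(1,3) by blast
          ultimately obtain y where y: "{a, x} = {a', y}" "meets y b'" unfolding 2(3) by blast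
          then have "a = a' \<and> x = y \<or> a = y \<and> x = a'" by (simp only: doubleton_eq_iff)
          then have "(a' = a \<or> a' = x) \<and> meets a b' \<and> meets x b'"
            using y(2) p(4) by metis
          then show "p \<in> {(a, b), (x, b)}" using u p by blast
        qed
        thus ?thesis by (rule two)
      next
        case (3 x)
        have u: "a' = a" if "a' \<in> A" "meets a' b" "meets a' x" for a'
          using K that 3(1,2,4) I unfolding K22_free_def by metis
        have "C e \<subseteq> {(a, b), (a, x)}"
        proof
          fix p assume "p \<in> C e"
          then obtain a' b' where p: "p = (a', b')" and "(a', b') \<in> C e" by (cases p) simp
          then have p: "p = (a', b')" "a' \<in> A" "b' \<in> B" "meets a' b'"
            and "e = {a', b'} \<or> (\<exists>y\<in>A. y \<noteq> a' \<and> e = {a', y} \<and> meets y b')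
              \<or> (\<exists>y\<in>B. y \<noteq> b' \<and> e = {y, b'} \<and> meets a' y)"
            unfolding C_def incidences_def by simp_all
          moreover have "a' \<notin> e" using p(2) I(2) disj 3(1,3) by blast
          ultimately obtain y where y: "{x, b} = {y, b'}" "meets a' y" unfolding 3(3) by blast
          then have "x = y \<and> b = b' \<or> x = b' \<and> b = y" by (simp only: doubleton_eq_iff)
          then have "(b' = b \<or> b' = x) \<and> meets a' b \<and> meets a' x"
            using y(2) p(4) by metis
          then show "p \<in> {(a, b), (a, x)}" using u p by blast
        qed
        thus ?thesis by (rule two)
      qed
    qed simp
  qed
  finally show "(card ?I + 1) div 2 \<le> card E'" by simp
qed

text \<open>Disjointness inside both families makes the graph bipartite, so a walk from
  \<open>a\<close> to \<open>b\<close> alternates sides. Length 2 is then impossible, and a walk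
  \<open>a\<close>, \<open>x\<close>, \<open>y\<close>, \<open>b\<close> of length 3 closes a
  forbidden four-cycle unless it uses the edge \<open>{a, b}\<close> itself.\<close>

lemma spanners_require_3_families:
  fixes A B :: "'a set set"
  assumes fin: "finite A" "finite B" and disj: "A \<inter> B = {}" and K: "K22_free meets A B"
    and A: "pairwise disjnt A" and B: "pairwise disjnt B"
  shows "spanners_require 3 (A \<union> B) (card (incidences meets A B))"
  unfolding spanners_require_def
proof (intro allI impI)
  fix E' assume sp: "hop_spanner 3 (A \<union> B) (intersection_edges (A \<union> B)) E'"
  let ?I = "incidences meets A B"
  have E': "E' \<subseteq> intersection_edges (A \<union> B)" using sp by (simp add: hop_spanner_def)
  have finE': "finite E'" using E' fin finite_subset by (metis finite_UnI finite_intersection_edges)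
  have nA: "y \<in> B \<and> meets x y" if "{x, y} \<in> E'" "x \<in> A" for x y
    using that E' A intersection_edge_iff[of x y "A \<union> B"] unfolding pairwise_def disjnt_def by blast
  have nB: "y \<in> A \<and> meets x y" if "{x, y} \<in> E'" "x \<in> B" for x y
    using that E' B intersection_edge_iff[of x y "A \<union> B"] unfolding pairwise_def disjnt_def by blast
  have edge: "{a, b} \<in> E'" if ab: "a \<in> A" "b \<in> B" "meets a b" for a b
  proof -
    have ne: "a \<noteq> b" using that disj by auto
    have "{a, b} \<in> intersection_edges (A \<union> B)"
      unfolding intersection_edge_iff using that ne by blast
    then obtain k where k: "k \<le> 3" "(a, b) \<in> adjacency E' ^^ k"
      using hop_spanner_edge[OF sp, of a b] ab(1,2) by blast
    have "k \<noteq> 0" using k ne by (cases k) auto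
    then consider "k = 1" | "k = Suc (Suc 0)" | "k = Suc (Suc (Suc 0))" using k by linarith
    then show ?thesis
    proof cases
      case 1
      then show ?thesis using k by (auto simp: adjacency_def)
    next
      case 2
      then obtain x where "{a, x} \<in> E'" "{x, b} \<in> E'"
        using k by (auto simp: adjacency_def)
      then show ?thesis using nA nB that disj by blast
    next
      case 3
      then obtain x y where xy: "{a, x} \<in> E'" "{x, y} \<in> E'" "{y, b} \<in> E'"
        using k by (auto simp: adjacency_def)
      have "x \<in> B" "meets a x" using nA xy that by blast+
      moreover have "y \<in> A" "meets x y" using nB xy calculation by blast+
      moreover have "meets y b" using nA xy calculation by blast
      ultimately have "a = y \<or> x = b"
        using K that unfolding K22_free_def by (metis inf_commute)
      then show ?thesis using xy by auto
    qed
  qed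
  have "card ?I = card ((\<lambda>(a, b). {a, b}) ` ?I)"
    using disj by (intro card_image[symmetric])
      (auto simp: inj_on_def incidences_def doubleton_eq_iff)
  also have "\<dots> \<le> card E'"
  proof (rule card_mono[OF finE'])
    show "(\<lambda>(a, b). {a, b}) ` ?I \<subseteq> E'"
      unfolding incidences_def by (rule image_subsetI) (use edge in \<open>simp split: prod.splits\<close>)
  qed
  finally show "card ?I \<le> card E'" .
qed

section \<open>From families of bodies to indexed incidence structures\<close>

lemma realized_incidences:
  fixes \<phi> :: "'i \<Rightarrow> 'a set" and \<psi> :: "'j \<Rightarrow> 'a set"
  assumes inj: "inj_on \<phi> A" "inj_on \<psi> B"
    and R: "\<And>i j. i \<in> A \<Longrightarrow> j \<in> B \<Longrightarrow> meets (\<phi> i) (\<psi> j) \<longleftrightarrow> R i j"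
    and K: "K22_free R A B"
  shows "card (incidences meets (\<phi> ` A) (\<psi> ` B)) = card (incidences R A B)"
    and "K22_free meets (\<phi> ` A) (\<psi> ` B)"
proof -
  have "incidences meets (\<phi> ` A) (\<psi> ` B) = map_prod \<phi> \<psi> ` incidences R A B"
  proof (intro set_eqI iffI)
    fix p assume "p \<in> incidences meets (\<phi> ` A) (\<psi> ` B)"
    then obtain i j where "p = (\<phi> i, \<psi> j)" "i \<in> A" "j \<in> B" "R i j"
      using R unfolding incidences_def by blast
    then show "p \<in> map_prod \<phi> \<psi> ` incidences R A B" by (force simp: incidences_def)
  next
    fix p assume "p \<in> map_prod \<phi> \<psi> ` incidences R A B"
    then obtain i j where "p = (\<phi> i, \<psi> j)" "i \<in> A" "j \<in> B" "R i j"
      by (auto simp: incidences_def)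
    then show "p \<in> incidences meets (\<phi> ` A) (\<psi> ` B)"
      using R unfolding incidences_def by blast
  qed
  moreover have "inj_on (map_prod \<phi> \<psi>) (incidences R A B)"
    using inj by (auto simp: inj_on_def incidences_def)
  ultimately show "card (incidences meets (\<phi> ` A) (\<psi> ` B)) = card (incidences R A B)"
    by (simp add: card_image)
  show "K22_free meets (\<phi> ` A) (\<psi> ` B)"
    unfolding K22_free_def ball_simps(9)
  proof (intro ballI impI)
    fix i i' j j' assume i: "i \<in> A" "i' \<in> A" "j \<in> B" "j' \<in> B"
      and "meets (\<phi> i) (\<psi> j) \<and> meets (\<phi> i) (\<psi> j') \<and> meets (\<phi> i') (\<psi> j) \<and> meets (\<phi> i') (\<psi> j')"
    hence "R i j \<and> R i j' \<and> R i' j \<and> R i' j'" using R by simp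
    hence "i = i' \<or> j = j'" using K i unfolding K22_free_def by blast
    thus "\<phi> i = \<phi> i' \<or> \<psi> j = \<psi> j'" by blast
  qed
qed

lemma spanners_require_2_incidences:
  fixes \<phi> :: "'i \<Rightarrow> 'a set" and \<psi> :: "'j \<Rightarrow> 'a set"
  assumes fin: "finite A" "finite B" and inj: "inj_on \<phi> A" "inj_on \<psi> B"
    and disj: "\<And>i j. i \<in> A \<Longrightarrow> j \<in> B \<Longrightarrow> \<phi> i \<noteq> \<psi> j"
    and R: "\<And>i j. i \<in> A \<Longrightarrow> j \<in> B \<Longrightarrow> meets (\<phi> i) (\<psi> j) \<longleftrightarrow> R i j"
    and K: "K22_free R A B"
  shows "card (\<phi> ` A \<union> \<psi> ` B) = card A + card B"
    and "spanners_require 2 (\<phi> ` A \<union> \<psi> ` B) ((card (incidences R A B) + 1) div 2)"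
proof -
  have d: "\<phi> ` A \<inter> \<psi> ` B = {}" using disj by blast
  then show "card (\<phi> ` A \<union> \<psi> ` B) = card A + card B"
    using fin inj by (simp add: card_Un_disjoint card_image)
  note r = realized_incidences[where R = R, OF inj R K]
  show "spanners_require 2 (\<phi> ` A \<union> \<psi> ` B) ((card (incidences R A B) + 1) div 2)"
    using spanners_require_2_families[OF _ _ d r(2)] fin r(1) by simp
qed

text \<open>Nonempty pairwise disjoint bodies are distinct, which supplies the injectivity that the
  2-hop version assumes.\<close>

lemma spanners_require_3_incidences:
  fixes \<phi> :: "'i \<Rightarrow> 'a set" and \<psi> :: "'j \<Rightarrow> 'a set"
  assumes fin: "finite A" "finite B"
    and ne: "\<And>i. i \<in> A \<Longrightarrow> \<phi> i \<noteq> {}" "\<And>j. j \<in> B \<Longrightarrow> \<psi> j \<noteq> {}"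
    and dA: "\<And>i i'. i \<in> A \<Longrightarrow> i' \<in> A \<Longrightarrow> i \<noteq> i' \<Longrightarrow> \<phi> i \<inter> \<phi> i' = {}"
    and dB: "\<And>j j'. j \<in> B \<Longrightarrow> j' \<in> B \<Longrightarrow> j \<noteq> j' \<Longrightarrow> \<psi> j \<inter> \<psi> j' = {}"
    and disj: "\<And>i j. i \<in> A \<Longrightarrow> j \<in> B \<Longrightarrow> \<phi> i \<noteq> \<psi> j"
    and R: "\<And>i j. i \<in> A \<Longrightarrow> j \<in> B \<Longrightarrow> meets (\<phi> i) (\<psi> j) \<longleftrightarrow> R i j"
    and K: "K22_free R A B"
  shows "card (\<phi> ` A \<union> \<psi> ` B) = card A + card B"
    and "spanners_require 3 (\<phi> ` A \<union> \<psi> ` B) (card (incidences R A B))"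
proof -
  have inj: "inj_on \<phi> A" using ne(1) dA unfolding inj_on_def by (metis inf.idem)
  have inj': "inj_on \<psi> B" using ne(2) dB unfolding inj_on_def by (metis inf.idem)
  have d: "\<phi> ` A \<inter> \<psi> ` B = {}" using disj by blast
  then show "card (\<phi> ` A \<union> \<psi> ` B) = card A + card B"
    using fin inj inj' by (simp add: card_Un_disjoint card_image)
  note r = realized_incidences[where R = R, OF inj inj' R K]
  have "pairwise disjnt (\<phi> ` A)"
    using dA unfolding pairwise_def disjnt_def by (metis imageE)
  moreover have "pairwise disjnt (\<psi> ` B)"
    using dB unfolding pairwise_def disjnt_def by (metis imageE)
  ultimately show "spanners_require 3 (\<phi> ` A \<union> \<psi> ` B) (card (incidences R A B))"
    using spanners_require_3_families[OF _ _ d r(2)] fin r(1) by simp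
qed

text \<open>A bound is chosen separately for each \<open>n\<close>. Where no good family is known,
  \<open>f n\<close> is 0, a requirement that every family meets; so all \<open>n\<close> from 1 on
  are covered while the asymptotics are unaffected.\<close>

lemma Omega_realization:
  fixes g :: "nat \<Rightarrow> real" and F :: "nat \<Rightarrow> 'a set set \<Rightarrow> bool"
  assumes c: "c > 0"
    and ev: "\<forall>\<^sub>F n in sequentially. \<exists>F m. card F = n \<and> P F \<and> spanners_require t F m \<and> c * \<bar>g n\<bar> \<le> real m"
    and ex: "\<And>n. n \<ge> 1 \<Longrightarrow> \<exists>F. card F = n \<and> P F"
  shows "\<exists>f::nat \<Rightarrow> nat. (\<lambda>n. real (f n)) \<in> \<Omega>(g) \<and>
     (\<forall>n\<ge>1. \<exists>F :: 'a set set. card F = n \<and> P F \<and> spanners_require t F (f n))"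
proof -
  let ?Q = "\<lambda>n m. \<exists>F. card F = n \<and> P F \<and> spanners_require t F m \<and> c * \<bar>g n\<bar> \<le> real m"
  define f where "f n = (if \<exists>m. ?Q n m then SOME m. ?Q n m else 0)" for n
  have f: "?Q n (f n)" if "\<exists>m. ?Q n m" for n
    using someI_ex[OF that] that by (simp add: f_def)
  have "\<forall>\<^sub>F n in sequentially. c * \<bar>g n\<bar> \<le> \<bar>real (f n)\<bar>"
    using ev by eventually_elim (use f in fastforce)
  hence "(\<lambda>n. real (f n)) \<in> \<Omega>(g)"
    using c by (intro landau_omega.bigI[of c]) auto
  moreover have "\<exists>F. card F = n \<and> P F \<and> spanners_require t F (f n)" if "n \<ge> 1" for n
  proof (cases "\<exists>m. ?Q n m")
    case True
    then show ?thesis using f by blast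
  next
    case False
    then have "f n = 0" unfolding f_def by (rule if_not_P)
    then show ?thesis using ex[OF that] by simp
  qed
  ultimately show ?thesis by blast
qed

section \<open>Points and boxes\<close>

text \<open>The van der Corput radical inverse of the \<open>t\<close> lowest digits in base
  \<open>q\<close>, scaled by \<open>q ^ t\<close> so that it stays integral.\<close>

fun digit_rev :: "nat \<Rightarrow> nat \<Rightarrow> nat \<Rightarrow> nat" where
  "digit_rev q 0 m = 0"
| "digit_rev q (Suc t) m = (m mod q) * q ^ t + digit_rev q t (m div q)"

lemma digit_rev_less: "q > 0 \<Longrightarrow> digit_rev q t m < q ^ t"
proof (induction t arbitrary: m)
  case (Suc t)
  have "digit_rev q (Suc t) m < (m mod q) * q ^ t + q ^ t" using Suc by simp
  also have "\<dots> = Suc (m mod q) * q ^ t" by simp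
  also have "\<dots> \<le> q * q ^ t"
    using Suc.prems by (intro mult_right_mono) (auto simp: Suc_le_eq)
  finally show ?case by simp
qed simp

text \<open>The leading digits of the reversal are the trailing digits of \<open>m\<close> in
  reverse order; the division cuts off the others.\<close>

lemma digit_rev_div:
  "q > 0 \<Longrightarrow> e \<le> t \<Longrightarrow> digit_rev q t m div q ^ (t - e) = digit_rev q e m"
proof (induction t arbitrary: e m)
  case (Suc t)
  show ?case
  proof (cases e)
    case 0
    then show ?thesis using digit_rev_less[OF Suc.prems(1), of "Suc t" m] by simp
  next
    case (Suc e')
    then have e': "e' \<le> t" using Suc.prems by simp
    have "digit_rev q (Suc t) m = ((m mod q) * q ^ e') * q ^ (t - e') + digit_rev q t (m div q)"
      using e' by (simp add: mult.assoc flip: power_add)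
    also have "\<dots> div q ^ (t - e') = (m mod q) * q ^ e' + digit_rev q t (m div q) div q ^ (t - e')"
      using Suc.prems(1) by simp
    finally show ?thesis using Suc.IH[OF Suc.prems(1) e'] Suc by simp
  qed
qed simp

lemma digit_rev_eq_iff:
  "q > 0 \<Longrightarrow> digit_rev q e m = digit_rev q e m' \<longleftrightarrow> m mod q ^ e = m' mod q ^ e"
proof (induction e arbitrary: m m')
  case (Suc e)
  have q: "q ^ e > 0" using Suc.prems by simp
  have split: "a * k + b = a' * k + b' \<longleftrightarrow> a = a' \<and> b = b'"
    if "b < k" "b' < k" for a a' b b' k :: nat
  proof
    assume eq: "a * k + b = a' * k + b'"
    have "(a * k + b) div k = a" "(a' * k + b') div k = a'" using that by simp_all
    then show "a = a' \<and> b = b'" using eq by simp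
  qed simp
  have "digit_rev q (Suc e) m = digit_rev q (Suc e) m' \<longleftrightarrow>
      m mod q = m' mod q \<and> digit_rev q e (m div q) = digit_rev q e (m' div q)"
    using split digit_rev_less[OF Suc.prems] by simp
  also have "\<dots> \<longleftrightarrow> (m div q mod q ^ e) * q + m mod q = (m' div q mod q ^ e) * q + m' mod q"
    using split[of "m mod q" q "m' mod q"] Suc by (auto simp del: add.commute)
  also have "\<dots> \<longleftrightarrow> m mod q ^ Suc e = m' mod q ^ Suc e"
    by (simp add: mod_mult2_eq mult.commute)
  finally show ?case .
qed simp

text \<open>Values with the same \<open>e\<close> leading digits fill an interval of length
  \<open>q ^ (t - e)\<close>, and the leading digits of the reversal of \<open>m\<close> encode
  \<open>m mod q ^ e\<close>. This is how residue classes become intervals.\<close>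

lemma digit_rev_interval:
  assumes "q > 0" "e \<le> t"
  shows "digit_rev q e r * q ^ (t - e) \<le> digit_rev q t m \<and>
      digit_rev q t m \<le> digit_rev q e r * q ^ (t - e) + (q ^ (t - e) - 1) \<longleftrightarrow>
    m mod q ^ e = r mod q ^ e"
proof -
  let ?k = "digit_rev q e r" and ?w = "q ^ (t - e)" and ?y = "digit_rev q t m"
  have w: "?w > 0" using assms by simp
  have "?y \<le> ?k * ?w + (?w - 1) \<longleftrightarrow> ?y < Suc ?k * ?w" using w by (simp only: mult_Suc) linarith
  hence "?k * ?w \<le> ?y \<and> ?y \<le> ?k * ?w + (?w - 1) \<longleftrightarrow> ?k \<le> ?y div ?w \<and> ?y div ?w < Suc ?k"
    using w by (simp only: less_eq_div_iff_mult_less_eq div_less_iff_less_mult)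
  also have "\<dots> \<longleftrightarrow> ?y div ?w = ?k" by auto
  also have "\<dots> \<longleftrightarrow> m mod q ^ e = r mod q ^ e"
    using digit_rev_div[OF assms] digit_rev_eq_iff[OF assms(1)] by simp
  finally show ?thesis .
qed

text \<open>Coordinates are indexed by numbers below \<open>D\<close> rather than by a type, so that
  \<open>D\<close> may be any function of the dimension in which the boxes are realized.\<close>

definition in_box :: "nat \<Rightarrow> ('b \<Rightarrow> nat \<Rightarrow> 'c::ord) \<Rightarrow> ('b \<Rightarrow> nat \<Rightarrow> 'c) \<Rightarrow> ('a \<Rightarrow> nat \<Rightarrow> 'c) \<Rightarrow> 'a \<Rightarrow> 'b \<Rightarrow> bool"
  where "in_box D lo hi y i l \<longleftrightarrow> (\<forall>j<D. lo l j \<le> y i j \<and> y i j \<le> hi l j)"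

text \<open>The Chinese remainder theorem; it merges the conditions on the single coordinates into
  one residue.\<close>

lemma mod_eq_prod_iff:
  fixes m r :: nat
  assumes "\<And>i j. i \<in> A \<Longrightarrow> j \<in> A \<Longrightarrow> i \<noteq> j \<Longrightarrow> coprime (k i) (k j)" "finite A"
  shows "(\<forall>j\<in>A. m mod k j = r mod k j) \<longleftrightarrow> m mod prod k A = r mod prod k A"
proof
  assume "\<forall>j\<in>A. m mod k j = r mod k j"
  then show "m mod prod k A = r mod prod k A"
    using coprime_cong_prod_nat[of A k m r] assms by (simp add: cong_def)
next
  assume "m mod prod k A = r mod prod k A"
  then show "\<forall>j\<in>A. m mod k j = r mod k j"
    using assms(2) by (metis dvd_prod_eqI mod_mod_cancel)
qed

text \<open>The interface between counting and geometry: \<open>n\<close> counts points and boxes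
  together, \<open>N\<close> their incidences. Natural coordinates leave a gap of 1 for the shifts
  made by the realizations.\<close>

definition box_incidences_realizable :: "nat \<Rightarrow> nat \<Rightarrow> nat \<Rightarrow> bool" where
  "box_incidences_realizable D n N \<longleftrightarrow>
     (\<exists>(lo::nat \<Rightarrow> nat \<Rightarrow> nat) hi (y::nat \<Rightarrow> nat \<Rightarrow> nat) n1 n2. n1 + n2 = n \<and>
        (\<forall>l j. lo l j \<le> hi l j) \<and> K22_free (in_box D lo hi y) {..<n1} {..<n2} \<and>
        card (incidences (in_box D lo hi y) {..<n1} {..<n2}) = N)"

text \<open>There are \<open>s ^ (D - 1)\<close> shapes with at most \<open>Q1 ^ (t - 1)\<close>
  boxes each, so the boxes use up at most half of \<open>n\<close> and the rest can be points. A
  product of \<open>t\<close> bases is at least \<open>Q0 ^ t\<close>, so points below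
  \<open>n\<close> are determined by their residue modulo it.\<close>

lemma exists_coprime_box_incidences:
  fixes D s t n Q0 Q1 :: nat and q :: "nat \<Rightarrow> nat"
  assumes D: "D \<ge> 1" and s: "s \<ge> 1" and t: "t = (D - 1) * s + 1"
    and cop: "\<And>i j. i < D \<Longrightarrow> j < D \<Longrightarrow> i \<noteq> j \<Longrightarrow> coprime (q i) (q j)"
    and Q: "Q0 \<ge> 1" "\<And>j. j < D \<Longrightarrow> Q0 \<le> q j \<and> q j \<le> Q1"
    and n: "n \<le> Q0 ^ t" "2 * (s ^ (D - 1) * Q1 ^ (t - 1)) \<le> n"
  shows "\<exists>n1. n \<le> 2 * n1 \<and> box_incidences_realizable D n (n1 * s ^ (D - 1))"
proof -
  define E :: "(nat \<Rightarrow> nat) set" where "E = ({..<D - 1} \<rightarrow>\<^sub>E {..<s})"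
  have finE: "finite E" and cardE: "card E = s ^ (D - 1)"
    by (simp_all add: E_def finite_PiE card_PiE)
  \<comment> \<open>The first \<open>D - 1\<close> exponents are free below \<open>s\<close>, and
    the last one completes the sum to \<open>(D - 1) * s\<close>, which is \<open>t - 1\<close>. The
    subtraction never truncates because of the bound on the free exponents.\<close>
  define x where "x e j = (if j = D - 1 then (D - 1) * s - (\<Sum>i<D - 1. e i) else e j)"
    for e :: "nat \<Rightarrow> nat" and j
  have DS: "{..<D} = insert (D - 1) {..<D - 1}" using D by auto
  have sum_x: "(\<Sum>j<D. x e j) = t - 1" if "e \<in> E" for e
  proof -
    have "(\<Sum>i<D - 1. e i) \<le> (\<Sum>i<D - 1. s)"
      using that by (intro sum_mono less_imp_le) (auto simp: E_def PiE_iff)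
    moreover have "(\<Sum>j<D. x e j) = x e (D - 1) + (\<Sum>j<D - 1. x e j)" by (simp add: DS)
    moreover have "(\<Sum>j<D - 1. x e j) = (\<Sum>j<D - 1. e j)" by (intro sum.cong) (auto simp: x_def)
    ultimately show ?thesis by (simp add: x_def t)
  qed
  have x_le: "x e j \<le> t" if "e \<in> E" "j < D" for e j
    using member_le_sum[of j "{..<D}" "x e"] sum_x that by simp
  have q0: "q j > 0" if "j < D" for j using Q that by fastforce
  define M where "M e = (\<Prod>j<D. q j ^ x e j)" for e
  have M0: "M e > 0" for e using q0 by (auto simp: M_def intro!: prod_pos)
  have M_le: "M e \<le> Q1 ^ (t - 1)" if "e \<in> E" for e
  proof -
    have "M e \<le> (\<Prod>j<D. Q1 ^ x e j)"
      unfolding M_def using Q by (intro prod_mono) (auto intro: power_mono)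
    also have "\<dots> = Q1 ^ (t - 1)" using sum_x[OF that] by (simp flip: power_sum)
    finally show ?thesis .
  qed
  \<comment> \<open>A box is a shape together with a residue modulo \<open>M e\<close>; the boxes of
    one shape partition the points.\<close>
  define L where "L = Sigma E (\<lambda>e. {..<M e})"
  have finL: "finite L" using finE by (simp add: L_def)
  have "card L = (\<Sum>e\<in>E. M e)" using finE by (simp add: L_def card_SigmaI)
  also have "\<dots> \<le> s ^ (D - 1) * Q1 ^ (t - 1)"
    using sum_bounded_above[of E M "Q1 ^ (t - 1)"] M_le cardE by simp
  finally have cardL: "2 * card L \<le> n" using n by linarith
  define n1 where "n1 = n - card L"
  obtain g where g: "bij_betw g {..<card L} L"
    using ex_bij_betw_nat_finite[OF finL] by (auto simp: lessThan_atLeast0)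
  define lo where "lo l j = digit_rev (q j) (x (fst (g l)) j) (snd (g l)) * q j ^ (t - x (fst (g l)) j)" for l j
  define hi where "hi l j = lo l j + (q j ^ (t - x (fst (g l)) j) - 1)" for l j
  define y where "y m j = digit_rev (q j) t m" for m j
  have gL: "fst (g l) \<in> E" "snd (g l) < M (fst (g l))" if "l < card L" for l
  proof -
    have "g l \<in> L" using bij_betwE[OF g] that by blast
    thus "fst (g l) \<in> E" "snd (g l) < M (fst (g l))" by (auto simp: L_def)
  qed
  have R: "in_box D lo hi y m l \<longleftrightarrow> snd (g l) = m mod M (fst (g l))" if l: "l < card L" for m l
  proof -
    let ?e = "fst (g l)" and ?r = "snd (g l)"
    have "lo l j \<le> y m j \<and> y m j \<le> hi l j \<longleftrightarrow> m mod q j ^ x ?e j = ?r mod q j ^ x ?e j" if "j < D" for j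
      unfolding lo_def hi_def y_def
      by (rule digit_rev_interval[OF q0[OF that] x_le[OF gL(1)[OF l] that]])
    hence "in_box D lo hi y m l \<longleftrightarrow> (\<forall>j<D. m mod q j ^ x ?e j = ?r mod q j ^ x ?e j)"
      unfolding in_box_def by blast
    also have "\<dots> \<longleftrightarrow> m mod M ?e = ?r mod M ?e"
      unfolding M_def using mod_eq_prod_iff[of "{..<D}" "\<lambda>j. q j ^ x ?e j" m ?r] cop by auto
    also have "\<dots> \<longleftrightarrow> ?r = m mod M ?e" using gL(2)[OF l] by auto
    finally show ?thesis .
  qed
  have "K22_free (in_box D lo hi y) {..<n1} {..<card L}"
    unfolding K22_free_def
  proof (intro ballI impI)
    fix m m' l l' assume "m \<in> {..<n1}" "m' \<in> {..<n1}" "l \<in> {..<card L}" "l' \<in> {..<card L}"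
      and I: "in_box D lo hi y m l \<and> in_box D lo hi y m l' \<and> in_box D lo hi y m' l \<and> in_box D lo hi y m' l'"
    hence l: "l < card L" "l' < card L" and m: "m < n" "m' < n" by (auto simp: n1_def)
    define e e' where "e = fst (g l)" and "e' = fst (g l')"
    have eE: "e \<in> E" "e' \<in> E" using gL l by (auto simp: e_def e'_def)
    have mm: "m mod M e = m' mod M e" "m mod M e' = m' mod M e'"
      and sn: "snd (g l) = m mod M e" "snd (g l') = m mod M e'"
      using I R[OF l(1)] R[OF l(2)] by (auto simp: e_def e'_def)
    show "m = m' \<or> l = l'"
    proof (cases "e = e'")
      case True
      hence "g l = g l'" using sn by (simp add: e_def e'_def prod_eq_iff)
      hence "l = l'" using g l by (auto simp: bij_betw_def inj_on_def)
      thus ?thesis ..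
    next
      case False
      \<comment> \<open>Agreement for both shapes is agreement modulo the product with the larger
        exponents. Different shapes of equal sum \<open>t - 1\<close> have a maximum of sum at least
        \<open>t\<close>, so this modulus reaches \<open>n\<close>.\<close>
      define z where "z j = max (x e j) (x e' j)" for j
      have "\<exists>j<D. x e j < x e' j"
      proof (rule ccontr)
        assume "\<not> ?thesis"
        hence le: "\<forall>j\<in>{..<D}. x e' j \<le> x e j" by (meson lessThan_iff not_less)
        obtain j where j: "j \<in> {..<D - 1}" "e j \<noteq> e' j"
          using False eE unfolding E_def by (metis PiE_ext)
        hence "j < D" "x e j \<noteq> x e' j" by (auto simp: x_def)
        with le have "(\<Sum>j<D. x e' j) < (\<Sum>j<D. x e j)"
          by (intro sum_strict_mono_ex1) (auto intro!: bexI[of _ j] simp: le_neq_implies_less)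
        thus False using sum_x eE by simp
      qed
      hence "(\<Sum>j<D. x e j) < (\<Sum>j<D. z j)"
        by (intro sum_strict_mono_ex1) (auto simp: z_def less_max_iff_disj)
      hence "t \<le> (\<Sum>j<D. z j)" using sum_x[OF eE(1)] t by simp
      hence "Q0 ^ t \<le> (\<Prod>j<D. Q0 ^ z j)" using Q by (simp add: power_increasing flip: power_sum)
      also have "\<dots> \<le> (\<Prod>j<D. q j ^ z j)"
        using Q by (intro prod_mono) (auto intro: power_mono)
      finally have big: "n \<le> (\<Prod>j<D. q j ^ z j)" using n by simp
      have "m mod q j ^ z j = m' mod q j ^ z j" if "j < D" for j
      proof -
        have "m mod q j ^ x e j = m' mod q j ^ x e j" "m mod q j ^ x e' j = m' mod q j ^ x e' j"
          using mm mod_eq_prod_iff[of "{..<D}" "\<lambda>j. q j ^ x e j" m m']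
            mod_eq_prod_iff[of "{..<D}" "\<lambda>j. q j ^ x e' j" m m'] cop that
          by (auto simp: M_def)
        thus ?thesis by (simp add: z_def max_def)
      qed
      hence "m mod (\<Prod>j<D. q j ^ z j) = m' mod (\<Prod>j<D. q j ^ z j)"
        using mod_eq_prod_iff[of "{..<D}" "\<lambda>j. q j ^ z j" m m'] cop by auto
      thus ?thesis using m big by simp
    qed
  qed
  moreover have "card (incidences (in_box D lo hi y) {..<n1} {..<card L}) = n1 * s ^ (D - 1)"
  proof -
    let ?I = "incidences (in_box D lo hi y) {..<n1} {..<card L}"
    \<comment> \<open>For each point and shape exactly one residue fits, so an incidence amounts to
      a point with a shape.\<close>
    have "bij_betw (\<lambda>(m, l). (m, fst (g l))) ?I ({..<n1} \<times> E)"
    proof (rule bij_betwI')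
      fix p p' assume "p \<in> ?I" "p' \<in> ?I"
      then obtain m l m' l' where p: "p = (m, l)" "p' = (m', l')" "l < card L" "l' < card L"
        "in_box D lo hi y m l" "in_box D lo hi y m' l'" by (auto simp: incidences_def)
      have "l = l'" if "m = m'" "fst (g l) = fst (g l')"
      proof -
        have "g l = g l'" using that p(5,6) R[OF p(3)] R[OF p(4)] by (simp add: prod_eq_iff)
        thus ?thesis using g p by (auto simp: bij_betw_def inj_on_def)
      qed
      thus "((\<lambda>(m, l). (m, fst (g l))) p = (\<lambda>(m, l). (m, fst (g l))) p') = (p = p')"
        by (auto simp: p)
    next
      fix p assume "p \<in> ?I"
      thus "(\<lambda>(m, l). (m, fst (g l))) p \<in> {..<n1} \<times> E" using gL by (auto simp: incidences_def)
    next
      fix p assume "p \<in> {..<n1} \<times> E"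
      then obtain m e where p: "p = (m, e)" "m < n1" "e \<in> E" by auto
      hence "(e, m mod M e) \<in> L" using M0 by (simp add: L_def)
      hence "(e, m mod M e) \<in> g ` {..<card L}" by (simp only: bij_betw_imp_surj_on[OF g])
      then obtain l where l: "l < card L" "g l = (e, m mod M e)" by auto
      hence "(m, l) \<in> ?I" using R[OF l(1)] p by (simp add: incidences_def)
      thus "\<exists>p'\<in>?I. p = (\<lambda>(m, l). (m, fst (g l))) p'" using l p by (intro bexI[of _ "(m, l)"]) auto
    qed
    thus ?thesis using cardE by (simp add: bij_betw_same_card card_cartesian_product)
  qed
  moreover have "n1 + card L = n" "n \<le> 2 * n1" using cardL by (auto simp: n1_def)
  moreover have "\<forall>l j. lo l j \<le> hi l j" by (simp add: hi_def)
  ultimately show ?thesis unfolding box_incidences_realizable_def by blast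
qed

text \<open>A common divisor divides \<open>G * (b - a)\<close> and is coprime to \<open>G\<close>;
  hence it divides \<open>b - a\<close>, and so \<open>G\<close>. With \<open>G = fact D\<close>
  this yields \<open>D\<close> pairwise coprime terms of an arithmetic progression, as in Goedel's
  beta function, and their differences stay below \<open>G * D\<close>.\<close>

lemma coprime_Suc_mult:
  fixes a b G :: nat
  assumes "a < b" "b - a dvd G"
  shows "coprime (G * a + 1) (G * b + 1)"
proof (rule coprimeI)
  fix d assume d: "d dvd G * a + 1" "d dvd G * b + 1"
  obtain k where "b = a + k" using assms(1) less_imp_add_positive by blast
  hence "G * b + 1 = G * a + 1 + G * (b - a)" by (simp add: algebra_simps)
  with d have "d dvd G * (b - a)" by (metis dvd_add_right_iff)
  moreover have co: "coprime d G"
  proof (rule coprimeI)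
    fix c assume "c dvd d" "c dvd G"
    thus "is_unit c" using d(1) by (metis dvd_add_right_iff dvd_mult2 dvd_trans)
  qed
  ultimately have "d dvd G" using assms(2) by (metis coprime_dvd_mult_right_iff dvd_trans)
  thus "is_unit d" using co by (metis coprime_absorb_left)
qed

text \<open>By comparison with \<open>exp\<close>, enlarging the base by \<open>a\<close> costs at
  most a factor 3 while \<open>a * k\<close> does not exceed \<open>q\<close>. It is applied with
  \<open>a\<close> as a bound on the spread of the bases.\<close>

lemma power_add_le:
  fixes a q :: real
  assumes "q > 0" "a \<ge> 0" "a * real k \<le> q"
  shows "(q + a) ^ k \<le> 3 * q ^ k"
proof -
  have "(q + a) ^ k = q ^ k * (1 + a / q) ^ k"
    using assms by (simp add: field_simps flip: power_mult_distrib)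
  also have "(1 + a / q) ^ k \<le> exp (a / q) ^ k"
    using assms by (intro power_mono exp_ge_add_one_self) auto
  also have "exp (a / q) ^ k = exp (a * k / q)" by (simp add: mult.commute flip: exp_of_nat_mult)
  also have "\<dots> \<le> exp 1" using assms by simp
  also have "\<dots> \<le> 3" by (rule exp_le)
  finally show ?thesis using assms by (simp add: mult.commute)
qed

text \<open>The bases start at the first \<open>G * c + 1\<close> whose power with exponent
  \<open>t\<close> reaches \<open>n\<close>. The preceding term \<open>q\<close> still has
  \<open>q ^ t < n\<close>, which limits the number of boxes, and the hypothesis on \<open>n\<close>
  makes \<open>q\<close> at least \<open>W\<close>.\<close>

lemma exists_box_incidences:
  fixes D s n :: nat
  assumes D: "D \<ge> 1" and s: "s \<ge> 1"
    and n: "(12 * fact D * (D + 1) * D * s ^ D) ^ (D * s) < n"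
  shows "\<exists>N. box_incidences_realizable D n N \<and> n * s ^ (D - 1) \<le> 2 * N"
proof -
  define G where "G = (fact D :: nat)"
  define t where "t = (D - 1) * s + 1"
  \<comment> \<open>\<open>W\<close> dominates \<open>G * ((D + 1) * D * s)\<close>, so that the
    spread of the bases costs only a factor 3, and \<open>6 * s ^ (D - 1)\<close>, where 6 is this
    factor times the 2 from keeping the boxes to half of \<open>n\<close>.\<close>
  define W where "W = 6 * G * (D + 1) * D * s ^ D"
  have G: "G \<ge> 1" by (simp add: G_def)
  have t: "t \<le> D * s" using D s by (cases D) (auto simp: t_def)
  have sD: "s \<le> s ^ D" "s ^ (D - 1) \<le> s ^ D" "1 \<le> s ^ D"
    using D s by (auto intro: self_le_power power_increasing)
  have GW: "G * ((D + 1) * D * s) \<le> W" "6 * s ^ (D - 1) \<le> W"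
  proof -
    have "G * ((D + 1) * D * s) \<le> G * ((D + 1) * D * s ^ D)"
      using sD by (intro mult_left_mono) auto
    thus "G * ((D + 1) * D * s) \<le> W" by (simp add: W_def algebra_simps)
    have "6 * s ^ (D - 1) \<le> 6 * s ^ D * 1" using sD by simp
    also have "\<dots> \<le> 6 * s ^ D * (G * (D + 1) * D)"
      using D G by (intro mult_left_mono) auto
    finally show "6 * s ^ (D - 1) \<le> W" by (simp add: W_def algebra_simps)
  qed
  have "1 \<le> (D + 1) * D * s" using D s by simp
  hence GW': "G \<le> W" using GW(1) order_trans[of G "G * ((D + 1) * D * s)" W] by simp
  have W2: "(2 * W) ^ (D * s) < n"
  proof -
    have "2 * W = 12 * fact D * (D + 1) * D * s ^ D" by (simp add: W_def G_def algebra_simps)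
    thus ?thesis using n by simp
  qed
  have "2 * W \<ge> 1" using GW' G by simp
  hence n1: "n > 1" using W2 one_le_power[of "2 * W" "D * s"] by linarith
  define c where "c = (LEAST c. n \<le> (G * c + 1) ^ t)"
  have "n \<le> G * n + 1" using G by (metis le_add1 mult_le_mono1 nat_mult_1 order_trans)
  also have "\<dots> \<le> (G * n + 1) ^ t" by (rule self_le_power) (auto simp: t_def)
  finally have c: "n \<le> (G * c + 1) ^ t" unfolding c_def by (rule LeastI)
  have "c \<noteq> 0" using c n1 by (intro notI) simp
  then obtain c' where c': "c = Suc c'" by (cases c) auto
  define q where "q = G * c' + 1"
  have qn: "q ^ t < n"
    using not_less_Least[of c' "\<lambda>c. n \<le> (G * c + 1) ^ t"] c' by (simp add: c_def q_def)
  have q0: "q + G = G * c + 1" by (simp add: q_def c')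
  \<comment> \<open>Otherwise the next base, \<open>q + G\<close>, would be at most
    \<open>2 * W\<close>, and its power could not reach \<open>n\<close>.\<close>
  have qW: "W \<le> q"
  proof (rule ccontr)
    assume "\<not> W \<le> q"
    hence "G * c + 1 \<le> 2 * W" using q0 GW' by linarith
    hence "(G * c + 1) ^ t \<le> (2 * W) ^ t" by (rule power_mono) simp
    also have "\<dots> \<le> (2 * W) ^ (D * s)" using t \<open>2 * W \<ge> 1\<close> by (rule power_increasing)
    finally show False using c W2 by linarith
  qed
  \<comment> \<open>The largest base is \<open>q + G * D\<close>, since the smallest one is
    \<open>q + G\<close>.\<close>
  define Q1 where "Q1 = q + G * (D + 1)"
  have "Q1 ^ (t - 1) \<le> 3 * q ^ (t - 1)"
  proof -
    have "t - 1 \<le> D * s" using t by simp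
    hence "G * (D + 1) * (t - 1) \<le> G * (D + 1) * (D * s)" by (rule mult_left_mono) simp
    also have "\<dots> \<le> q" using GW(1) qW by (simp add: algebra_simps)
    finally have "real (G * (D + 1) * (t - 1)) \<le> real q" by (simp only: of_nat_le_iff)
    hence "real (G * (D + 1)) * real (t - 1) \<le> real q" by (simp only: of_nat_mult)
    moreover have "q > 0" by (simp add: q_def)
    ultimately have "(real q + real (G * (D + 1))) ^ (t - 1) \<le> 3 * real q ^ (t - 1)"
      by (intro power_add_le) (simp_all only: of_nat_0_le_iff of_nat_0_less_iff)
    hence "real (Q1 ^ (t - 1)) \<le> real (3 * q ^ (t - 1))" by (simp add: Q1_def)
    thus ?thesis by (simp only: of_nat_le_iff)
  qed
  hence "2 * (s ^ (D - 1) * Q1 ^ (t - 1)) \<le> 2 * (s ^ (D - 1) * (3 * q ^ (t - 1)))"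
    by (intro mult_left_mono) auto
  also have "\<dots> = (6 * s ^ (D - 1)) * q ^ (t - 1)" by simp
  also have "\<dots> \<le> q * q ^ (t - 1)" using GW(2) qW by (intro mult_right_mono) auto
  also have "\<dots> = q ^ t" by (simp add: t_def)
  finally have few: "2 * (s ^ (D - 1) * Q1 ^ (t - 1)) \<le> n" using qn by simp
  have cop: "coprime (G * (c + i) + 1) (G * (c + j) + 1)" if "i < D" "j < D" "i \<noteq> j" for i j
  proof -
    have "coprime (G * (c + i) + 1) (G * (c + j) + 1)" if "i < j" "j < D" for i j
      using that by (intro coprime_Suc_mult) (auto simp: G_def intro!: dvd_fact)
    thus ?thesis using that by (metis coprime_commute linorder_neqE_nat)
  qed
  have range: "G * c + 1 \<le> G * (c + j) + 1 \<and> G * (c + j) + 1 \<le> Q1" if "j < D" for j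
  proof -
    have "G * j \<le> G * D" using that by simp
    thus ?thesis by (simp add: Q1_def q_def c' algebra_simps)
  qed
  have "1 \<le> G * c + 1" by simp
  have "\<exists>n1. n \<le> 2 * n1 \<and> box_incidences_realizable D n (n1 * s ^ (D - 1))"
    by (rule exists_coprime_box_incidences[where q = "\<lambda>j. G * (c + j) + 1",
          OF D s t_def cop \<open>1 \<le> G * c + 1\<close> range c few])
  then obtain n1 where n1: "n \<le> 2 * n1" "box_incidences_realizable D n (n1 * s ^ (D - 1))" by blast
  have "n * s ^ (D - 1) \<le> 2 * n1 * s ^ (D - 1)" using n1(1) by (rule mult_right_mono) simp
  thus ?thesis using n1(2) by (metis mult.assoc)
qed

text \<open>For \<open>s\<close> of order \<open>ln n / ln (ln n)\<close>, both \<open>ln C\<close>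
  and \<open>ln s\<close> are eventually at most \<open>ln (ln n)\<close>, so the threshold of
  \<open>exists_box_incidences\<close> has logarithm at most
  \<open>D * (D + 1) * s * ln (ln n)\<close>. The choice of \<open>k\<close> makes this at most half
  of \<open>ln n\<close>.\<close>

lemma box_incidences_asymptotics:
  fixes D :: nat
  assumes D: "D \<ge> 1"
  obtains c where "c > 0" "\<forall>\<^sub>F n in sequentially. \<exists>N. box_incidences_realizable D n N \<and>
    c * \<bar>real n * (ln (real n) / ln (ln (real n))) ^ (D - 1)\<bar> \<le> real N"
proof -
  define k where "k = 1 / (2 * real D * (real D + 1))"
  define C where "C = (12 * fact D * (D + 1) * D :: nat)"
  have k: "0 < k" "k \<le> 1" using D by (auto simp: k_def divide_simps mult_ge1_I intro!: add_pos_nonneg)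
  have C: "C \<ge> 1" using D by (simp add: C_def Suc_le_eq)
  \<comment> \<open>\<open>k / 2\<close> absorbs the rounding of \<open>s\<close>; the last 2 is the
    factor lost in \<open>exists_box_incidences\<close>.\<close>
  define c where "c = (k / 2) ^ (D - 1) / 2"
  have "\<forall>\<^sub>F n in sequentially. ln (real n) / ln (ln (real n)) \<ge> 2 / k"
    by real_asymp
  moreover have "\<forall>\<^sub>F n in sequentially. ln (ln (real n)) \<ge> max 1 (ln (real C))"
    by real_asymp
  moreover have "\<forall>\<^sub>F n in sequentially. n > (1::nat)" by (rule eventually_gt_at_top)
  ultimately have "\<forall>\<^sub>F n in sequentially. \<exists>N. box_incidences_realizable D n N \<and>
    c * \<bar>real n * (ln (real n) / ln (ln (real n))) ^ (D - 1)\<bar> \<le> real N"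
  proof eventually_elim
    case (elim n)
    define L where "L = ln (ln (real n))"
    define x where "x = ln (real n) / L"
    define s where "s = nat \<lfloor>k * x\<rfloor>"
    have L: "L \<ge> 1" "ln (real C) \<le> L" using elim by (auto simp: L_def)
    have x: "x \<ge> 2 / k" using elim by (simp add: x_def L_def)
    hence kx: "k * x \<ge> 2" using k by (simp add: field_simps)
    have ln: "ln (real n) = x * L" "ln (real n) > 0" using L elim by (auto simp: x_def)
    have x0: "x > 0" using x k by (smt (verit) divide_pos_pos)
    have s1: "real s \<le> k * x" using kx by (simp add: s_def)
    have "real s > k * x - 1" using kx by (simp add: s_def)
    hence s2: "real s \<ge> k * x / 2" using kx by simp
    hence "real s \<ge> 1" using kx by linarith
    hence s: "s \<ge> 1" by simp
    have "real s \<le> x" using s1 k x0 by (smt (verit) mult_left_le_one_le)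
    also have "x \<le> ln (real n)" unfolding ln(1) using L x0 by simp
    finally have "real s \<le> ln (real n)" .
    hence lns: "ln (real s) \<le> L" unfolding L_def using s ln(2)
      by (intro iffD2[OF ln_le_cancel_iff]) simp_all
    have "ln (real ((C * s ^ D) ^ (D * s))) = real (D * s) * (ln (real C) + real D * ln (real s))"
      using C s by (simp add: ln_realpow ln_mult)
    also have "\<dots> \<le> real (D * s) * (L + real D * L)"
      using L lns by (intro mult_left_mono add_mono) auto
    also have "\<dots> = real D * (real D + 1) * L * real s" by (simp add: algebra_simps)
    also have "\<dots> \<le> real D * (real D + 1) * L * (k * x)"
      using s1 L by (intro mult_left_mono) auto
    also have "\<dots> = ln (real n) / 2" using D by (simp add: k_def ln field_simps add_nonneg_eq_0_iff)
    also have "\<dots> < ln (real n)" using ln(2) by simp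
    finally have "real ((C * s ^ D) ^ (D * s)) < real n"
      using C s elim by (subst (asm) ln_less_cancel_iff) auto
    hence "(C * s ^ D) ^ (D * s) < n" by (simp only: of_nat_less_iff)
    then obtain N where N: "box_incidences_realizable D n N" "n * s ^ (D - 1) \<le> 2 * N"
      using exists_box_incidences[OF D s] unfolding C_def by blast
    have "c * \<bar>real n * x ^ (D - 1)\<bar> = real n * (k * x / 2) ^ (D - 1) / 2"
      using x0 by (simp add: c_def abs_mult power_mult_distrib power_divide)
    also have "\<dots> \<le> real n * real s ^ (D - 1) / 2"
      using s2 kx by (intro divide_right_mono mult_left_mono power_mono) auto
    also have "\<dots> = real (n * s ^ (D - 1)) / 2" by simp
    also have "\<dots> \<le> real (2 * N) / 2" by (rule divide_right_mono[OF of_nat_mono[OF N(2)]]) simp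
    finally show ?case using N(1) by (auto simp: x_def L_def)
  qed
  moreover have "c > 0" using k by (simp add: c_def)
  ultimately show ?thesis using that by blast
qed

section \<open>Realization by boxes and hypercubes\<close>

lemma cbox_meets_iff:
  fixes a b c d :: "real^'d"
  assumes "\<And>i. a $ i \<le> b $ i" "\<And>i. c $ i \<le> d $ i"
  shows "meets (cbox a b) (cbox c d) \<longleftrightarrow> (\<forall>i. a $ i \<le> d $ i \<and> c $ i \<le> b $ i)"
proof
  assume "meets (cbox a b) (cbox c d)"
  then obtain x where "x \<in> cbox a b" "x \<in> cbox c d" by blast
  then show "\<forall>i. a $ i \<le> d $ i \<and> c $ i \<le> b $ i"
    unfolding mem_box_cart by (metis order_trans)
next
  assume *: "\<forall>i. a $ i \<le> d $ i \<and> c $ i \<le> b $ i"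
  have "(\<chi> i. max (a $ i) (c $ i)) \<in> cbox a b \<inter> cbox c d"
    using * assms by (auto simp: mem_box_cart)
  then show "meets (cbox a b) (cbox c d)" by blast
qed

abbreviation cube :: "real^'d \<Rightarrow> real \<Rightarrow> (real^'d) set" where
  "cube a s \<equiv> cbox a (\<chi> i. a $ i + s)"

lemma cube_meets_iff:
  "s \<ge> 0 \<Longrightarrow> meets (cube a s) (cube b s) \<longleftrightarrow> (\<forall>i. a $ i \<le> b $ i + s \<and> b $ i \<le> a $ i + s)"
  by (subst cbox_meets_iff) auto

lemma cube_eqD:
  assumes "cube a s = cube b s" "s \<ge> 0"
  shows "a = b"
proof -
  have "a \<in> cube a s" "b \<in> cube b s" using assms(2) by (auto simp: mem_box_cart)
  hence "a \<in> cube b s" "b \<in> cube a s" using assms(1) by simp_all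
  then show ?thesis by (auto simp: mem_box_cart vec_eq_iff intro: antisym)
qed

lemma congruent_sets_translation:
  fixes S :: "'a::real_normed_vector set"
  shows "congruent_sets S ((+) a ` S)"
  unfolding congruent_sets_def by (intro exI[of _ "(+) a"]) (simp add: dist_norm)

lemma congruent_cubes: "congruent_sets (cube a s) (cube b s)"
proof -
  have "(+) (b - a) ` cube a s = cube b s"
    unfolding cbox_translation[symmetric] by (rule arg_cong2[of _ _ _ _ cbox]) (simp_all add: vec_eq_iff)
  then show ?thesis using congruent_sets_translation by metis
qed

lemma axis_aligned_hypercube_cube: "s > 0 \<Longrightarrow> axis_aligned_hypercube (cube a s)"
  by (auto simp: axis_aligned_hypercube_def)

lemma axis_aligned_hypercube_imp_box: "axis_aligned_hypercube Q \<Longrightarrow> axis_aligned_box Q"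
  unfolding axis_aligned_hypercube_def axis_aligned_box_def
  by (metis (no_types, lifting) less_add_same_cancel1 vec_lambda_beta)

lemma coordinate_enumeration:
  obtains h :: "'d::finite \<Rightarrow> nat" where "bij_betw h UNIV {..<CARD('d)}"
  using ex_bij_betw_finite_nat[of "UNIV :: 'd set"] by (auto simp: lessThan_atLeast0)

text \<open>The spare coordinate puts the boxes of the second family on different levels, and every
  thickened point extends through all levels. In the other coordinates the points become cubes of
  side \<open>\<delta>\<close>, shifted by different multiples of \<open>2 * \<delta>\<close> so
  that even equal points come apart.\<close>

lemma exists_box_family:
  assumes D: "D \<ge> 1" "CARD('d) = D + 1" and N: "box_incidences_realizable D n N"
  shows "\<exists>F :: (real^'d) set set.
    card F = n \<and> (\<forall>B\<in>F. axis_aligned_box B) \<and> spanners_require 3 F N"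
proof -
  obtain lo hi y :: "nat \<Rightarrow> nat \<Rightarrow> nat" and n1 n2 where n: "n1 + n2 = n" and lohi: "\<And>l j. lo l j \<le> hi l j"
    and K: "K22_free (in_box D lo hi y) {..<n1} {..<n2}"
    and N: "card (incidences (in_box D lo hi y) {..<n1} {..<n2}) = N"
    using N unfolding box_incidences_realizable_def by blast
  obtain h :: "'d \<Rightarrow> nat" where h: "bij_betw h UNIV {..<D + 1}"
    using coordinate_enumeration D(2) by metis
  have hsurj: "\<exists>k. h k = j" if "j \<le> D" for j
  proof -
    have "j \<in> range h" using that h by (simp add: bij_betw_def)
    thus ?thesis by auto
  qed
  \<comment> \<open>Shift plus thickness stay below 1/2. With the margins 1/4 and 1/2 in
    \<open>c\<close> and \<open>d\<close>, every comparison of integers then keeps its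
    outcome.\<close>
  define \<delta> :: real where "\<delta> = 1 / (4 * (real n + 1))"
  have \<delta>: "\<delta> > 0" "\<delta> \<le> 1 / 4" by (simp_all add: \<delta>_def)
  have shift: "2 * real i * \<delta> + \<delta> < 1 / 2" if "i < n" for i
    using that by (simp add: \<delta>_def divide_simps)
  define a b c d :: "nat \<Rightarrow> real^'d" where
    "a i = (\<chi> k. if h k < D then real (y i (h k)) + 2 * real i * \<delta> else -1)" and
    "b i = (\<chi> k. if h k < D then real (y i (h k)) + 2 * real i * \<delta> + \<delta> else 2 * real n2 + 1)" and
    "c l = (\<chi> k. if h k < D then real (lo l (h k)) - 1 / 4 else 2 * real l)" and
    "d l = (\<chi> k. if h k < D then real (hi l (h k)) + 1 / 2 else 2 * real l + 1)" for i l
  have ab: "a i $ k < b i $ k" and cd: "c l $ k < d l $ k" for i l k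
    using \<delta> lohi[of l "h k"] by (auto simp: a_def b_def c_def d_def)
  define \<phi> \<psi> where "\<phi> i = cbox (a i) (b i)" and "\<psi> l = cbox (c l) (d l)" for i l
  have ne: "\<phi> i \<noteq> {}" "\<psi> l \<noteq> {}" for i l
    using ab cd by (auto simp: \<phi>_def \<psi>_def interval_ne_empty_cart intro: less_imp_le)
  have dA: "\<phi> i \<inter> \<phi> i' = {}" if "i \<in> {..<n1}" "i' \<in> {..<n1}" "i \<noteq> i'" for i i'
  proof (rule ccontr)
    assume "meets (\<phi> i) (\<phi> i')"
    hence m: "\<And>k. a i $ k \<le> b i' $ k \<and> a i' $ k \<le> b i $ k"
      unfolding \<phi>_def using cbox_meets_iff[OF less_imp_le[OF ab] less_imp_le[OF ab]] by blast
    obtain k where "h k = 0" using hsurj by blast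
    with m[of k] D have *: "real (y i 0) + 2 * real i * \<delta> \<le> real (y i' 0) + 2 * real i' * \<delta> + \<delta>"
      "real (y i' 0) + 2 * real i' * \<delta> \<le> real (y i 0) + 2 * real i * \<delta> + \<delta>"
      by (simp_all add: a_def b_def)
    have "0 \<le> 2 * real i * \<delta>" "0 \<le> 2 * real i' * \<delta>" using \<delta> by auto
    moreover have "2 * real i * \<delta> + \<delta> < 1 / 2" "2 * real i' * \<delta> + \<delta> < 1 / 2"
      using shift that n by auto
    ultimately have "real (y i 0) < real (y i' 0) + 1" "real (y i' 0) < real (y i 0) + 1"
      using * \<delta> by linarith+
    hence "y i 0 = y i' 0" by linarith
    hence "(2 * real i) * \<delta> \<le> (2 * real i' + 1) * \<delta>" "(2 * real i') * \<delta> \<le> (2 * real i + 1) * \<delta>"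
      using * by (simp_all add: algebra_simps)
    hence "2 * real i \<le> 2 * real i' + 1" "2 * real i' \<le> 2 * real i + 1"
      using \<delta> by (simp_all only: mult_le_cancel_right_pos)
    hence "i = i'" by linarith
    thus False using that by simp
  qed
  have dB: "\<psi> l \<inter> \<psi> l' = {}" if "l \<noteq> l'" for l l'
  proof (rule ccontr)
    assume "meets (\<psi> l) (\<psi> l')"
    hence m: "\<And>k. c l $ k \<le> d l' $ k \<and> c l' $ k \<le> d l $ k"
      unfolding \<psi>_def using cbox_meets_iff[OF less_imp_le[OF cd] less_imp_le[OF cd]] by blast
    obtain k where "h k = D" using hsurj by blast
    with m[of k] have "2 * real l \<le> 2 * real l' + 1" "2 * real l' \<le> 2 * real l + 1"
      by (simp_all add: c_def d_def)
    thus False using that by linarith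
  qed
  \<comment> \<open>In the spare coordinate a thickened point reaches down to -1, while every box
    starts at 0 or above.\<close>
  have disj: "\<phi> i \<noteq> \<psi> l" for i l
  proof
    assume eq: "\<phi> i = \<psi> l"
    have "a i \<in> \<phi> i" using ab by (simp add: \<phi>_def mem_box_cart less_imp_le)
    hence "\<forall>k. c l $ k \<le> a i $ k" unfolding eq by (simp add: \<psi>_def mem_box_cart)
    moreover obtain k where "h k = D" using hsurj by blast
    ultimately have "2 * real l \<le> -1" by (auto simp: a_def c_def dest: spec[of _ k])
    thus False by simp
  qed
  have R: "meets (\<phi> i) (\<psi> l) \<longleftrightarrow> in_box D lo hi y i l" if "i \<in> {..<n1}" "l \<in> {..<n2}" for i l
  proof -
    have sh: "0 \<le> 2 * real i * \<delta>" "2 * real i * \<delta> + \<delta> < 1 / 2" using shift \<delta> that n by auto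
    have "meets (\<phi> i) (\<psi> l) \<longleftrightarrow> (\<forall>k. a i $ k \<le> d l $ k \<and> c l $ k \<le> b i $ k)"
      unfolding \<phi>_def \<psi>_def by (intro cbox_meets_iff less_imp_le ab cd)
    also have "\<dots> \<longleftrightarrow> (\<forall>k. h k < D \<longrightarrow> lo l (h k) \<le> y i (h k) \<and> y i (h k) \<le> hi l (h k))"
    proof (rule all_cong1)
      fix k
      have "real (y i (h k)) + 2 * real i * \<delta> \<le> real (hi l (h k)) + 1 / 2 \<longleftrightarrow> y i (h k) \<le> hi l (h k)"
        using sh \<delta> by linarith
      moreover have "real (lo l (h k)) - 1 / 4 \<le> real (y i (h k)) + 2 * real i * \<delta> + \<delta>
          \<longleftrightarrow> lo l (h k) \<le> y i (h k)"
        using sh \<delta> by linarith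
      ultimately show "(a i $ k \<le> d l $ k \<and> c l $ k \<le> b i $ k) \<longleftrightarrow>
          (h k < D \<longrightarrow> lo l (h k) \<le> y i (h k) \<and> y i (h k) \<le> hi l (h k))"
        using that by (auto simp: a_def b_def c_def d_def)
    qed
    also have "\<dots> \<longleftrightarrow> in_box D lo hi y i l"
      unfolding in_box_def using hsurj less_imp_le by metis
    finally show ?thesis .
  qed
  note result = spanners_require_3_incidences[where R = "in_box D lo hi y" and \<phi> = \<phi> and \<psi> = \<psi>,
      OF finite_lessThan finite_lessThan ne dA dB disj R K]
  have "axis_aligned_box (\<phi> i)" "axis_aligned_box (\<psi> l)" for i l
    unfolding axis_aligned_box_def \<phi>_def \<psi>_def using ab cd by blast+
  then show ?thesis
    using result n N by (intro exI[of _ "\<phi> ` {..<n1} \<union> \<psi> ` {..<n2}"]) auto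
qed

text \<open>Coordinate \<open>j\<close> sets the upper face of a point cube against the lower face
  of a box cube and so tests \<open>lo \<le> y\<close>; coordinate \<open>D + j\<close> exchanges
  the roles and tests \<open>y \<le> hi\<close>. Cubes of one family may overlap, hence only a 2-hop
  bound.\<close>

lemma exists_hypercube_family:
  assumes D: "D \<ge> 1" "2 * D \<le> CARD('d)" and N: "box_incidences_realizable D n N"
  shows "\<exists>F :: (real^'d) set set. card F = n \<and> (\<forall>Q\<in>F. axis_aligned_hypercube Q) \<and>
    pairwise congruent_sets F \<and> spanners_require 2 F ((N + 1) div 2)"
proof -
  obtain lo hi y :: "nat \<Rightarrow> nat \<Rightarrow> nat" and n1 n2 where n: "n1 + n2 = n" and lohi: "\<And>l j. lo l j \<le> hi l j"
    and K: "K22_free (in_box D lo hi y) {..<n1} {..<n2}"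
    and N: "card (incidences (in_box D lo hi y) {..<n1} {..<n2}) = N"
    using N unfolding box_incidences_realizable_def by blast
  obtain h :: "'d \<Rightarrow> nat" where h: "bij_betw h UNIV {..<CARD('d)}"
    using coordinate_enumeration by metis
  have hsurj: "\<exists>k. h k = j" if "j < 2 * D" for j
  proof -
    have "j \<in> range h" using that h D by (simp add: bij_betw_def)
    thus ?thesis by auto
  qed
  define \<delta> :: real where "\<delta> = 1 / (4 * (real n + 1))"
  have \<delta>: "\<delta> > 0" by (simp add: \<delta>_def)
  have shift: "2 * real i * \<delta> < 1 / 2" if "i < n" for i
    using that by (simp add: \<delta>_def divide_simps)
  \<comment> \<open>The sums are a crude common bound on all coordinates. With a side this large,
    the inequality that a coordinate is not meant to test always holds.\<close>
  define s :: real where "s = 2 + (\<Sum>i<n1. \<Sum>j<D. real (y i j)) + (\<Sum>l<n2. \<Sum>j<D. real (hi l j))"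
  have ys: "real (y i j) + 2 \<le> s" if "i < n1" "j < D" for i j
  proof -
    have "real (y i j) \<le> (\<Sum>j<D. real (y i j))" using that by (intro member_le_sum) auto
    also have "\<dots> \<le> (\<Sum>i<n1. \<Sum>j<D. real (y i j))"
      using that by (intro member_le_sum[where f = "\<lambda>i. \<Sum>j<D. real (y i j)"]) (auto intro: sum_nonneg)
    moreover have "0 \<le> (\<Sum>l<n2. \<Sum>j<D. real (hi l j))" by (intro sum_nonneg) auto
    ultimately show ?thesis by (simp add: s_def)
  qed
  have hs: "real (hi l j) + 2 \<le> s" if "l < n2" "j < D" for l j
  proof -
    have "real (hi l j) \<le> (\<Sum>j<D. real (hi l j))" using that by (intro member_le_sum) auto
    also have "\<dots> \<le> (\<Sum>l<n2. \<Sum>j<D. real (hi l j))"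
      using that by (intro member_le_sum[where f = "\<lambda>l. \<Sum>j<D. real (hi l j)"]) (auto intro: sum_nonneg)
    moreover have "0 \<le> (\<Sum>i<n1. \<Sum>j<D. real (y i j))" by (intro sum_nonneg) auto
    ultimately show ?thesis by (simp add: s_def)
  qed
  have s: "s > 0" unfolding s_def by (intro add_pos_nonneg sum_nonneg) auto
  \<comment> \<open>The shifts only have to make cubes of the same family distinct. A coordinate
    left over in odd dimension, or beyond \<open>2 * D\<close>, is 0 for all cubes.\<close>
  define a b :: "nat \<Rightarrow> real^'d" where
    "a i = (\<chi> k. if h k < D then real (y i (h k)) + 2 * real i * \<delta> - s
        else if h k < 2 * D then real (y i (h k - D)) + 2 * real i * \<delta> else 0)" and
    "b l = (\<chi> k. if h k < D then real (lo l (h k))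
        else if h k < 2 * D then real (hi l (h k - D)) + 1 / 2 + 2 * real l * \<delta> - s else 0)" for i l
  define \<phi> \<psi> where "\<phi> i = cube (a i) s" and "\<psi> l = cube (b l) s" for i l
  obtain k0 where k0: "h k0 = D" using hsurj[of D] D by auto
  have inj_a: "inj_on \<phi> {..<n1}"
  proof (rule inj_onI)
    fix i i' assume i: "i \<in> {..<n1}" "i' \<in> {..<n1}" and "\<phi> i = \<phi> i'"
    hence "a i = a i'" unfolding \<phi>_def by - (rule cube_eqD[OF _ less_imp_le[OF s]])
    hence "a i $ k0 = a i' $ k0" by simp
    hence *: "real (y i 0) + 2 * real i * \<delta> = real (y i' 0) + 2 * real i' * \<delta>"
      using k0 D by (simp add: a_def)
    moreover have "0 \<le> 2 * real i * \<delta>" "0 \<le> 2 * real i' * \<delta>" using \<delta> by auto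
    moreover have "2 * real i * \<delta> < 1 / 2" "2 * real i' * \<delta> < 1 / 2" using shift i n by auto
    ultimately have "y i 0 = y i' 0" by linarith
    with * show "i = i'" using \<delta> by simp
  qed
  have inj_b: "inj_on \<psi> {..<n2}"
  proof (rule inj_onI)
    fix i i' assume i: "i \<in> {..<n2}" "i' \<in> {..<n2}" and "\<psi> i = \<psi> i'"
    hence "b i = b i'" unfolding \<psi>_def by - (rule cube_eqD[OF _ less_imp_le[OF s]])
    hence "b i $ k0 = b i' $ k0" by simp
    hence *: "real (hi i 0) + 2 * real i * \<delta> = real (hi i' 0) + 2 * real i' * \<delta>"
      using k0 D by (simp add: b_def)
    moreover have "0 \<le> 2 * real i * \<delta>" "0 \<le> 2 * real i' * \<delta>" using \<delta> by auto
    moreover have "2 * real i * \<delta> < 1 / 2" "2 * real i' * \<delta> < 1 / 2" using shift i n by auto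
    ultimately have "hi i 0 = hi i' 0" by linarith
    with * show "i = i'" using \<delta> by simp
  qed
  have disj: "\<phi> i \<noteq> \<psi> l" if "i \<in> {..<n1}" "l \<in> {..<n2}" for i l
  proof
    assume "\<phi> i = \<psi> l"
    hence "a i = b l" unfolding \<phi>_def \<psi>_def by - (rule cube_eqD[OF _ less_imp_le[OF s]])
    hence "a i $ k0 = b l $ k0" by simp
    hence "real (y i 0) + 2 * real i * \<delta> = real (hi l 0) + 1 / 2 + 2 * real l * \<delta> - s"
      using k0 D by (simp add: a_def b_def)
    moreover have "0 \<le> 2 * real i * \<delta>" "2 * real l * \<delta> < 1 / 2" using \<delta> shift[of l] that n by auto
    moreover have "real (hi l 0) + 2 \<le> s" using hs that D by simp
    ultimately show False by linarith
  qed
  have R: "meets (\<phi> i) (\<psi> l) \<longleftrightarrow> in_box D lo hi y i l" if il: "i \<in> {..<n1}" "l \<in> {..<n2}" for i l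
  proof -
    have sh: "0 \<le> 2 * real i * \<delta>" "2 * real i * \<delta> < 1 / 2" "0 \<le> 2 * real l * \<delta>" "2 * real l * \<delta> < 1 / 2"
      using shift \<delta> that n by auto
    have "meets (\<phi> i) (\<psi> l) \<longleftrightarrow> (\<forall>k. a i $ k \<le> b l $ k + s \<and> b l $ k \<le> a i $ k + s)"
      unfolding \<phi>_def \<psi>_def by (rule cube_meets_iff[OF less_imp_le[OF s]])
    also have "\<dots> \<longleftrightarrow> (\<forall>k. (h k < D \<longrightarrow> lo l (h k) \<le> y i (h k)) \<and>
        (D \<le> h k \<and> h k < 2 * D \<longrightarrow> y i (h k - D) \<le> hi l (h k - D)))"
    proof (rule all_cong1)
      fix k
      consider "h k < D" | "D \<le> h k" "h k < 2 * D" | "2 * D \<le> h k" by linarith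
      then show "(a i $ k \<le> b l $ k + s \<and> b l $ k \<le> a i $ k + s) \<longleftrightarrow>
          (h k < D \<longrightarrow> lo l (h k) \<le> y i (h k)) \<and>
          (D \<le> h k \<and> h k < 2 * D \<longrightarrow> y i (h k - D) \<le> hi l (h k - D))"
      proof cases
        case 1
        have "real (lo l (h k)) \<le> real (y i (h k)) + 2 * real i * \<delta> \<longleftrightarrow> lo l (h k) \<le> y i (h k)"
          using sh by linarith
        moreover have "real (y i (h k)) + 2 * real i * \<delta> - s \<le> real (lo l (h k)) + s"
          using sh ys[of i "h k"] il 1 s by simp
        ultimately show ?thesis using 1 by (simp add: a_def b_def)
      next
        case 2
        let ?j = "h k - D"
        have j: "?j < D" using 2 by simp
        have "real (y i ?j) + 2 * real i * \<delta> \<le> real (hi l ?j) + 1 / 2 + 2 * real l * \<delta> \<longleftrightarrow> y i ?j \<le> hi l ?j"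
          using sh by linarith
        moreover have "real (hi l ?j) + 1 / 2 + 2 * real l * \<delta> - s \<le> real (y i ?j) + 2 * real i * \<delta> + s"
        proof -
          have "real (hi l ?j) + 2 \<le> s" using hs il j by simp
          thus ?thesis using sh s of_nat_0_le_iff[of "y i ?j"] by linarith
        qed
        ultimately show ?thesis using 2 by (simp add: a_def b_def)
      next
        case 3
        then show ?thesis using s by (simp add: a_def b_def)
      qed
    qed
    also have "\<dots> \<longleftrightarrow> in_box D lo hi y i l"
      unfolding in_box_def
    proof safe
      fix j assume *: "\<forall>k. (h k < D \<longrightarrow> lo l (h k) \<le> y i (h k)) \<and>
        (D \<le> h k \<and> h k < 2 * D \<longrightarrow> y i (h k - D) \<le> hi l (h k - D))" and j: "j < D"
      obtain k where "h k = j" using hsurj[of j] j by auto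
      then show "lo l j \<le> y i j" using * j by blast
      obtain k where "h k = D + j" using hsurj[of "D + j"] j by auto
      then show "y i j \<le> hi l j" using *[rule_format, of k] j by simp
    qed auto
    finally show ?thesis .
  qed
  note result = spanners_require_2_incidences[where R = "in_box D lo hi y" and \<phi> = \<phi> and \<psi> = \<psi>,
      OF finite_lessThan finite_lessThan inj_a inj_b disj R K]
  let ?F = "\<phi> ` {..<n1} \<union> \<psi> ` {..<n2}"
  have "\<forall>Q\<in>?F. \<exists>p. Q = cube p s" by (auto simp: \<phi>_def \<psi>_def)
  hence "\<forall>Q\<in>?F. axis_aligned_hypercube Q" "pairwise congruent_sets ?F"
    unfolding pairwise_def using axis_aligned_hypercube_cube[OF s] congruent_cubes by metis+
  then show ?thesis
    using result n N by (intro exI[of _ ?F]) auto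
qed

text \<open>Each cube meets at most one other, so every edge must be kept. This serves dimension 1,
  where no coordinate remains for the digit construction, and also shows that families of every size
  exist.\<close>

lemma exists_hypercube_matching:
  "\<exists>F :: (real^'d) set set. card F = n \<and> (\<forall>Q\<in>F. axis_aligned_hypercube Q) \<and>
    pairwise congruent_sets F \<and> spanners_require 3 F (n div 2)"
proof -
  define \<phi> \<psi> :: "nat \<Rightarrow> (real^'d) set" where
    "\<phi> i = cube (\<chi> k. 4 * real i) 2" and "\<psi> i = cube (\<chi> k. 4 * real i + 1) 2" for i
  define n1 n2 where "n1 = n - n div 2" and "n2 = n div 2"
  have ne: "\<phi> i \<noteq> {}" "\<psi> i \<noteq> {}" for i by (auto simp: \<phi>_def \<psi>_def interval_ne_empty_cart)
  have d: "\<phi> i \<inter> \<phi> i' = {}" "\<psi> i \<inter> \<psi> i' = {}" if "i \<noteq> i'" for i i'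
  proof -
    have "\<not> (4 * real i \<le> 4 * real i' + 2 \<and> 4 * real i' \<le> 4 * real i + 2)" using that by linarith
    hence "\<not> meets (\<phi> i) (\<phi> i')" "\<not> meets (\<psi> i) (\<psi> i')"
      unfolding \<phi>_def \<psi>_def by (subst cube_meets_iff; simp add: add.commute)+
    then show "\<phi> i \<inter> \<phi> i' = {}" "\<psi> i \<inter> \<psi> i' = {}" by simp_all
  qed
  have disj: "\<phi> i \<noteq> \<psi> l" for i l
  proof
    assume "\<phi> i = \<psi> l"
    hence "(\<chi> k. 4 * real i) = (\<chi> k. 4 * real l + 1 :: real^'d)"
      unfolding \<phi>_def \<psi>_def by (rule cube_eqD) simp
    hence "real (4 * i) = real (4 * l + 1)" by (simp add: vec_eq_iff)
    hence "4 * i = 4 * l + 1" by (simp only: of_nat_eq_iff)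
    thus False by presburger
  qed
  have R: "meets (\<phi> i) (\<psi> l) \<longleftrightarrow> i = l" for i l
  proof -
    have "meets (\<phi> i) (\<psi> l) \<longleftrightarrow> 4 * real i \<le> 4 * real l + 3 \<and> 4 * real l + 1 \<le> 4 * real i + 2"
      unfolding \<phi>_def \<psi>_def by (subst cube_meets_iff) auto
    also have "\<dots> \<longleftrightarrow> i = l" by linarith
    finally show ?thesis .
  qed
  have K: "K22_free (=) {..<n1} {..<n2}" by (auto simp: K22_free_def)
  note result = spanners_require_3_incidences[where R = "(=)" and \<phi> = \<phi> and \<psi> = \<psi>,
      OF finite_lessThan finite_lessThan ne d disj R K]
  have "incidences (=) {..<n1} {..<n2} = (\<lambda>i. (i, i)) ` {..<n2}"
    by (auto simp: incidences_def n1_def n2_def)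
  hence "card (incidences (=) {..<n1} {..<n2}) = n div 2" by (simp add: card_image inj_on_def n2_def)
  moreover have "n1 + n2 = n" by (simp add: n1_def n2_def)
  moreover let ?F = "\<phi> ` {..<n1} \<union> \<psi> ` {..<n2}"
  have "\<forall>Q\<in>?F. \<exists>p. Q = cube p 2" unfolding \<phi>_def \<psi>_def by blast
  hence "\<forall>Q\<in>?F. axis_aligned_hypercube Q" "pairwise congruent_sets ?F"
    unfolding pairwise_def using axis_aligned_hypercube_cube[of 2] congruent_cubes
    by (metis zero_less_numeral)+
  ultimately show ?thesis using result by (intro exI[of _ ?F]) auto
qed

section \<open>Points and lines\<close>

text \<open>A point is \<open>(abscissa, ordinate)\<close> and a line is
  \<open>(slope, intercept)\<close>; vertical lines do not occur.\<close>

definition on_line :: "nat \<times> nat \<Rightarrow> nat \<times> nat \<Rightarrow> bool" where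
  "on_line p l \<longleftrightarrow> snd p = fst l * fst p + snd l"

lemma K22_free_on_line: "K22_free on_line P L"
  unfolding K22_free_def
proof (intro ballI impI)
  fix p p' l l'
  assume "on_line p l \<and> on_line p l' \<and> on_line p' l \<and> on_line p' l'"
  moreover obtain a b a' b' m c m' c' where
    eq: "p = (a, b)" "p' = (a', b')" "l = (m, c)" "l' = (m', c')" by (metis surj_pair)
  ultimately have *: "b = m * a + c" "b = m' * a + c'" "b' = m * a' + c" "b' = m' * a' + c'"
    by (auto simp: on_line_def)
  show "p = p' \<or> l = l'"
  proof (cases "a = a'")
    case True
    then show ?thesis using * eq by simp
  next
    case False
    \<comment> \<open>The integers avoid truncated subtraction when the slopes are compared.\<close>
    have "int m * a + c = int m' * a + c'" "int m * a' + c = int m' * a' + c'"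
      using * by (metis of_nat_add of_nat_mult)+
    hence "(int m - int m') * (int a - int a') = 0" by (simp add: algebra_simps)
    hence "m = m'" using False by simp
    then show ?thesis using * eq by simp
  qed
qed

text \<open>The grid is high enough, \<open>m * a + c < 2 * k ^ 2\<close>, for each of the
  \<open>k ^ 3\<close> lines to hit a grid point in all \<open>k\<close> columns.\<close>

lemma exists_point_line_incidences:
  assumes "3 * k ^ 3 \<le> n"
  obtains P L where "finite P" "finite L" "card P + card L = n"
    "k ^ 4 \<le> card (incidences on_line P L)"
proof -
  define L where "L = {..<k} \<times> {..<k ^ 2}"
  \<comment> \<open>The extra column at abscissa \<open>k\<close> is padding that brings the total
    to exactly \<open>n\<close>.\<close>
  define P where "P = {..<k} \<times> {..<2 * k ^ 2} \<union> {k} \<times> {..<n - 3 * k ^ 3}"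
  have "card P = 2 * k ^ 3 + (n - 3 * k ^ 3)"
    unfolding P_def by (subst card_Un_disjoint) (auto simp: card_cartesian_product power2_eq_square power3_eq_cube)
  moreover have "card L = k ^ 3" by (simp add: L_def card_cartesian_product power2_eq_square power3_eq_cube)
  ultimately have card: "card P + card L = n" using assms by simp
  have fin: "finite P" "finite L" by (simp_all add: P_def L_def)
  let ?g = "\<lambda>(a, l). ((a, fst l * a + snd l), l)"
  have "?g ` ({..<k} \<times> L) \<subseteq> incidences on_line P L"
  proof (rule image_subsetI)
    fix q assume "q \<in> {..<k} \<times> L"
    then obtain a m c where q: "q = (a, (m, c))" and a: "a \<in> {..<k}" "(m, c) \<in> L" by auto
    have "m * a \<le> k * k" using a by (intro mult_mono) (auto simp: L_def)
    hence "m * a + c < 2 * k ^ 2" using a by (simp add: L_def power2_eq_square)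
    then show "?g q \<in> incidences on_line P L"
      using a by (simp add: q incidences_def on_line_def P_def)
  qed
  hence "card (?g ` ({..<k} \<times> L)) \<le> card (incidences on_line P L)"
    using fin by (intro card_mono) auto
  moreover have "card (?g ` ({..<k} \<times> L)) = card ({..<k} \<times> L)"
    by (intro card_image) (auto simp: inj_on_def)
  moreover have "card ({..<k} \<times> L) = k ^ 4"
    by (simp add: L_def card_cartesian_product power2_eq_square power4_eq_xxxx)
  ultimately show ?thesis using that fin card by simp
qed

lemma point_line_lower_bound:
  fixes Q :: "'a set set \<Rightarrow> bool"
  assumes real: "\<And>P L :: (nat \<times> nat) set. finite P \<Longrightarrow> finite L \<Longrightarrow>
    \<exists>F. card F = card P + card L \<and> Q F \<and> spanners_require t F ((card (incidences on_line P L) + 1) div 2)"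
  shows "\<exists>f::nat \<Rightarrow> nat. (\<lambda>n. real (f n)) \<in> \<Omega>(\<lambda>n. real n powr (4/3)) \<and>
     (\<forall>n\<ge>1. \<exists>F. card F = n \<and> Q F \<and> spanners_require t F (f n))"
proof (rule Omega_realization)
  \<comment> \<open>In 32, the factor \<open>2 ^ 4\<close> pays for rounding the cube root of
    \<open>n / 3\<close> down to \<open>k\<close>, and the factor 2 for the halved count.\<close>
  define c :: real where "c = (1 / 3) powr (4/3) / 32"
  show "c > 0" by (simp add: c_def)
  have "\<forall>\<^sub>F n in sequentially. n \<ge> (3::nat)" by (rule eventually_ge_at_top)
  then show "\<forall>\<^sub>F n in sequentially. \<exists>F m. card F = n \<and> Q F \<and> spanners_require t F m \<and>
      c * \<bar>real n powr (4/3)\<bar> \<le> real m"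
  proof eventually_elim
    case (elim n)
    define x where "x = (real n / 3) powr (1/3)"
    define k where "k = nat \<lfloor>x\<rfloor>"
    have x: "x \<ge> 1" using elim by (simp add: x_def ge_one_powr_ge_zero)
    have "\<lfloor>x\<rfloor> \<ge> 1" using x by simp
    moreover have "real k = of_int \<lfloor>x\<rfloor>" using x by (simp add: k_def)
    ultimately have k: "real k \<le> x" "real k \<ge> x / 2" by linarith+
    have x3: "x ^ 3 = real n / 3" "x ^ 4 = (1 / 3) powr (4/3) * real n powr (4/3)"
      using elim x by (simp_all add: x_def powr_powr flip: powr_realpow powr_mult)
    have "real k ^ 3 \<le> x ^ 3" using k by (intro power_mono) auto
    hence "real (3 * k ^ 3) \<le> real n" using x3 by simp
    hence "3 * k ^ 3 \<le> n" by (simp only: of_nat_le_iff)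
    then obtain P L where PL: "finite P" "finite L" "card P + card L = n"
      "k ^ 4 \<le> card (incidences on_line P L)" by (rule exists_point_line_incidences)
    let ?m = "(card (incidences on_line P L) + 1) div 2"
    obtain F where F: "card F = n" "Q F" "spanners_require t F ?m"
      using real[OF PL(1,2)] PL(3) by auto
    have "k ^ 4 \<le> 2 * ?m" using PL(4) by linarith
    hence "real (k ^ 4) \<le> real (2 * ?m)" by (simp only: of_nat_le_iff)
    hence "real k ^ 4 / 2 \<le> real ?m" by simp
    moreover have "(x / 2) ^ 4 \<le> real k ^ 4" using k x by (intro power_mono) auto
    moreover have "c * \<bar>real n powr (4/3)\<bar> = (x / 2) ^ 4 / 2"
      by (simp add: c_def x3 power_divide)
    ultimately have "c * \<bar>real n powr (4/3)\<bar> \<le> real ?m" by linarith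
    then show ?case using F by blast
  qed
  show "\<exists>F. card F = n \<and> Q F" for n
  proof -
    have "card ({0::nat} \<times> {..<n}) = n" by (simp add: card_cartesian_product)
    then show ?thesis using real[of "{0} \<times> {..<n}" "{}"] by fastforce
  qed
qed

section \<open>Congruent balls\<close>

lemma exhaust_5: "x = 1 \<or> x = 2 \<or> x = 3 \<or> x = 4 \<or> x = 5" for x :: 5
proof (induct x)
  case (of_int z)
  then have "z = 0 \<or> z = 1 \<or> z = 2 \<or> z = 3 \<or> z = 4" by fastforce
  then show ?case by auto
qed

lemma sum_5: "sum f (UNIV :: 5 set) = f 1 + f 2 + f 3 + f 4 + f 5"
proof -
  have U: "(UNIV :: 5 set) = {1, 2, 3, 4, 5}" using exhaust_5 by auto
  show ?thesis unfolding U by (simp add: ac_simps)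
qed

definition vec5 :: "real \<Rightarrow> real \<Rightarrow> real \<Rightarrow> real \<Rightarrow> real \<Rightarrow> real^5" where
  "vec5 a b c d e = (\<chi> i. if i = 1 then a else if i = 2 then b else if i = 3 then c else if i = 4 then d else e)"

lemma vec5_nth [simp]:
  "vec5 a b c d e $ 1 = a" "vec5 a b c d e $ 2 = b" "vec5 a b c d e $ 3 = c"
  "vec5 a b c d e $ 4 = d" "vec5 a b c d e $ 5 = e"
  by (simp_all add: vec5_def)

lemma dist_vec5:
  "dist (vec5 a b c d e) (vec5 a' b' c' d' e') ^ 2 =
     (a - a')\<^sup>2 + (b - b')\<^sup>2 + (c - c')\<^sup>2 + (d - d')\<^sup>2 + (e - e')\<^sup>2"
  by (simp add: dist_norm norm_vec_def L2_set_def sum_5 sum_nonneg)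

lemma cball_meets_iff:
  fixes x y :: "'a::real_normed_vector"
  assumes "r \<ge> 0"
  shows "meets (cball x r) (cball y r) \<longleftrightarrow> dist x y \<le> 2 * r"
proof
  assume "meets (cball x r) (cball y r)"
  then obtain z where "dist x z \<le> r" "dist y z \<le> r" by auto
  then show "dist x y \<le> 2 * r" using dist_triangle2[of x y z] by linarith
next
  assume *: "dist x y \<le> 2 * r"
  have "dist x (midpoint x y) \<le> r" "dist y (midpoint x y) \<le> r"
    using * by (simp_all add: dist_midpoint)
  then show "meets (cball x r) (cball y r)" by (metis disjoint_iff mem_cball)
qed

lemma congruent_sets_cball: "congruent_sets (cball x r) (cball y r)"
  for x y :: "'a::real_normed_vector"
proof -
  have "(+) (y - x) ` cball x r = cball y r" by (metis cball_translation diff_add_cancel)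
  then show ?thesis
    unfolding congruent_sets_def by (intro exI[of _ "(+) (y - x)"]) (simp add: dist_norm)
qed

text \<open>
  The square \<open>(b - m a - c)\<^sup>2\<close> is, up to terms depending on the point or the line only, the scalar
  product of the vectors \<open>u\<close>, \<open>v\<close> in four dimensions. The fifth coordinates \<open>e\<^sup>2 * w p\<close> and
  \<open>1 + e\<^sup>2 * z l\<close> contribute these missing terms to the squared distance, up to an error of
  order \<open>e ^ 4\<close>.
\<close>

lemma exists_ball_family:
  fixes P L :: "(nat \<times> nat) set"
  assumes fin: "finite P" "finite L"
  shows "\<exists>F :: (real^5) set set. card F = card P + card L \<and>
    ((\<forall>B\<in>F. solid_ball B) \<and> pairwise congruent_sets F) \<and>
    spanners_require 2 F ((card (incidences on_line P L) + 1) div 2)"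
proof -
  \<comment> \<open>Up to the factor \<open>e\<^sup>2\<close>, the first four squared differences
    add up to \<open>(b - m a - c)^2\<close> plus \<open>2 * w p - 2 * z l\<close>; the mixed term
    of the fifth coordinate cancels the latter.\<close>
  define w z :: "nat \<times> nat \<Rightarrow> real" where
    "w p = (let a = real (fst p); b = real (snd p) in ((a\<^sup>2)\<^sup>2 + (a * b)\<^sup>2 + a\<^sup>2) / 2)" and
    "z l = (let m = real (fst l); c = real (snd l) in - ((m\<^sup>2 / 2)\<^sup>2 + m\<^sup>2 + (m * c)\<^sup>2) / 2)" for p l
  define W where "W = 1 + (\<Sum>p\<in>P. \<Sum>l\<in>L. (z l - w p)\<^sup>2)"
  have W1: "W \<ge> 1" by (simp add: W_def sum_nonneg)
  have W: "(z l - w p)\<^sup>2 \<le> W" if "p \<in> P" "l \<in> L" for p l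
  proof -
    have "(z l - w p)\<^sup>2 \<le> (\<Sum>l\<in>L. (z l - w p)\<^sup>2)"
      using that fin by (intro member_le_sum[where f = "\<lambda>l. (z l - w p)\<^sup>2"]) auto
    also have "\<dots> \<le> (\<Sum>p\<in>P. \<Sum>l\<in>L. (z l - w p)\<^sup>2)"
      using that fin by (intro member_le_sum[where f = "\<lambda>p. \<Sum>l\<in>L. (z l - w p)\<^sup>2"]) (auto intro: sum_nonneg)
    finally show ?thesis by (simp add: W_def)
  qed
  \<comment> \<open>This makes the error \<open>e ^ 4 * W\<close> smaller than
    \<open>e\<^sup>2\<close>, the contribution of the smallest nonzero square.\<close>
  define e where "e = 1 / (2 * W)"
  have e: "e > 0" "e\<^sup>2 * W < 1"
    using W1 by (auto simp: e_def power2_eq_square field_simps)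
  \<comment> \<open>The squared diameter separates the two cases: incident pairs have squared
    distance at most \<open>1 + e ^ 4 * W\<close>, all others at least
    \<open>1 + e\<^sup>2\<close>.\<close>
  define r where "r = sqrt (1 + e ^ 4 * W) / 2"
  have r: "r > 0" "(2 * r)\<^sup>2 = 1 + e ^ 4 * W"
    using W1 e by (simp_all add: r_def add_pos_nonneg)
  define x y :: "nat \<times> nat \<Rightarrow> real^5" where
    "x p = (let a = real (fst p); b = real (snd p) in
       vec5 (e * a\<^sup>2) (e * (a * b)) (e * b) (e * a) (e\<^sup>2 * w p))" and
    "y l = (let m = real (fst l); c = real (snd l) in
       vec5 (- e * m\<^sup>2 / 2) (e * m) (e * c) (- e * (m * c)) (1 + e\<^sup>2 * z l))" for p l
  have dist: "dist (x p) (y l) ^ 2 =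
      1 + e\<^sup>2 * (real (snd p) - real (fst l) * real (fst p) - real (snd l))\<^sup>2 + e ^ 4 * (z l - w p)\<^sup>2" for p l
  proof -
    let ?a = "real (fst p)" and ?b = "real (snd p)" and ?m = "real (fst l)" and ?c = "real (snd l)"
    have "dist (x p) (y l) ^ 2 = e\<^sup>2 * ((?a\<^sup>2 + ?m\<^sup>2 / 2)\<^sup>2 + (?a * ?b - ?m)\<^sup>2 + (?b - ?c)\<^sup>2 + (?a + ?m * ?c)\<^sup>2)
        + (e\<^sup>2 * w p - (1 + e\<^sup>2 * z l))\<^sup>2"
      unfolding x_def y_def Let_def dist_vec5 by (simp add: power2_eq_square algebra_simps)
    also have "(e\<^sup>2 * w p - (1 + e\<^sup>2 * z l))\<^sup>2 = 1 + e\<^sup>2 * (2 * z l - 2 * w p) + e ^ 4 * (z l - w p)\<^sup>2"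
      by (simp add: power2_eq_square power4_eq_xxxx algebra_simps)
    also have "2 * z l = - ((?m\<^sup>2 / 2)\<^sup>2 + ?m\<^sup>2 + (?m * ?c)\<^sup>2)"
      by (simp add: z_def Let_def)
    also have "2 * w p = (?a\<^sup>2)\<^sup>2 + (?a * ?b)\<^sup>2 + ?a\<^sup>2"
      by (simp add: w_def Let_def)
    finally show ?thesis by (simp add: power2_eq_square algebra_simps)
  qed
  define \<phi> \<psi> where "\<phi> p = cball (x p) r" and "\<psi> l = cball (y l) r" for p l
  have inj: "inj_on \<phi> P" "inj_on \<psi> L"
  proof -
    show "inj_on \<phi> P"
    proof (rule inj_onI)
      fix p p' assume "\<phi> p = \<phi> p'"
      hence "x p = x p'" using r(1) by (simp add: \<phi>_def cball_eq_cball_iff)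
      hence "x p $ 3 = x p' $ 3" "x p $ 4 = x p' $ 4" by simp_all
      thus "p = p'" using e by (simp add: x_def Let_def prod_eq_iff)
    qed
    show "inj_on \<psi> L"
    proof (rule inj_onI)
      fix p p' assume "\<psi> p = \<psi> p'"
      hence "y p = y p'" using r(1) by (simp add: \<psi>_def cball_eq_cball_iff)
      hence "y p $ 2 = y p' $ 2" "y p $ 3 = y p' $ 3" by simp_all
      thus "p = p'" using e by (simp add: y_def Let_def prod_eq_iff)
    qed
  qed
  have disj: "\<phi> p \<noteq> \<psi> l" for p l
  proof
    assume "\<phi> p = \<psi> l"
    hence "x p = y l" using r(1) by (simp add: \<phi>_def \<psi>_def cball_eq_cball_iff)
    hence "dist (x p) (y l) ^ 2 = 0" by simp
    moreover have "dist (x p) (y l) ^ 2 \<ge> 1" unfolding dist by simp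
    ultimately show False by simp
  qed
  have R: "meets (\<phi> p) (\<psi> l) \<longleftrightarrow> on_line p l" if "p \<in> P" "l \<in> L" for p l
  proof -
    have "meets (\<phi> p) (\<psi> l) \<longleftrightarrow> dist (x p) (y l) \<le> 2 * r"
      unfolding \<phi>_def \<psi>_def using r by (intro cball_meets_iff) simp
    also have "\<dots> \<longleftrightarrow> dist (x p) (y l) ^ 2 \<le> (2 * r) ^ 2"
      using abs_le_square_iff[of "dist (x p) (y l)" "2 * r"] r(1) by simp
    also have "\<dots> \<longleftrightarrow> on_line p l"
    proof
      assume "on_line p l"
      hence "real (snd p) - real (fst l) * real (fst p) - real (snd l) = 0" by (simp add: on_line_def)
      thus "dist (x p) (y l) ^ 2 \<le> (2 * r) ^ 2" unfolding dist r(2) using W[OF that] e by simp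
    next
      assume le: "dist (x p) (y l) ^ 2 \<le> (2 * r) ^ 2"
      show "on_line p l"
      proof (rule ccontr)
        assume "\<not> on_line p l"
        hence "int (snd p) - int (fst l) * int (fst p) - int (snd l) \<noteq> 0"
          unfolding on_line_def by (metis diff_diff_eq eq_iff_diff_eq_0 of_nat_add of_nat_eq_iff of_nat_mult)
        hence "(int (snd p) - int (fst l) * int (fst p) - int (snd l))\<^sup>2 \<ge> 1"
          by (metis int_one_le_iff_zero_less zero_less_power2)
        hence "real_of_int ((int (snd p) - int (fst l) * int (fst p) - int (snd l))\<^sup>2) \<ge> 1" by linarith
        hence "(real (snd p) - real (fst l) * real (fst p) - real (snd l))\<^sup>2 \<ge> 1" by simp
        hence "e\<^sup>2 * 1 \<le> e\<^sup>2 * (real (snd p) - real (fst l) * real (fst p) - real (snd l))\<^sup>2"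
          by (rule mult_left_mono) simp
        moreover have "e\<^sup>2 * (e\<^sup>2 * W) < e\<^sup>2 * 1" using e by (intro mult_strict_left_mono) auto
        moreover have "e ^ 4 * W = e\<^sup>2 * (e\<^sup>2 * W)" by (simp add: power2_eq_square power4_eq_xxxx)
        moreover have "e ^ 4 * (z l - w p)\<^sup>2 \<ge> 0" by simp
        ultimately show False using le unfolding dist r(2) by linarith
      qed
    qed
    finally show ?thesis .
  qed
  note result = spanners_require_2_incidences[where R = on_line and \<phi> = \<phi> and \<psi> = \<psi>,
      OF fin inj disj R K22_free_on_line]
  let ?F = "\<phi> ` P \<union> \<psi> ` L"
  have "\<forall>B\<in>?F. \<exists>p. B = cball p r" unfolding \<phi>_def \<psi>_def by blast
  hence "\<forall>B\<in>?F. solid_ball B" "pairwise congruent_sets ?F"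
    unfolding pairwise_def solid_ball_def using r(1) congruent_sets_cball by metis+
  then show ?thesis using result by (intro exI[of _ ?F]) auto
qed

section \<open>Congruent polytopes touching a plane\<close>

definition rigid :: "('a::real_inner \<Rightarrow> 'a) \<Rightarrow> bool" where
  "rigid h \<longleftrightarrow> (\<exists>f a. orthogonal_transformation f \<and> h = (\<lambda>x. a + f x))"

lemma orthogonal_transformation_dist:
  "orthogonal_transformation f \<Longrightarrow> dist (f x) (f y) = dist x y"
  by (metis dist_norm linear_diff orthogonal_transformation_def orthogonal_transformation_norm)

lemma rigid_dist: "rigid h \<Longrightarrow> dist (h x) (h y) = dist x y"
  by (auto simp: rigid_def orthogonal_transformation_dist)

text \<open>\<open>congruent_sets\<close> asks for an isometry of the whole space; \<open>h'\<close>
  composed with the inverse of \<open>h\<close> is one.\<close>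

lemma congruent_sets_rigid_images:
  fixes h h' :: "'a::euclidean_space \<Rightarrow> 'a"
  assumes "rigid h" "rigid h'"
  shows "congruent_sets (h ` K) (h' ` K)"
proof -
  obtain f a where f: "orthogonal_transformation f" "h = (\<lambda>x. a + f x)"
    using assms(1) by (auto simp: rigid_def)
  define g where "g y = h' (inv f (y - a))" for y
  have "dist (g x) (g y) = dist x y" for x y
    using orthogonal_transformation_dist[OF orthogonal_transformation_inv[OF f(1)]] rigid_dist[OF assms(2)]
    by (simp add: g_def) (simp add: dist_norm)
  moreover have "g ` (h ` K) = h' ` K"
    using orthogonal_transformation_inj[OF f(1)] by (simp add: g_def f(2) image_comp o_def)
  ultimately show ?thesis unfolding congruent_sets_def by blast
qed

text \<open>The reflection along \<open>g - d\<close> exchanges \<open>g\<close> and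
  \<open>d\<close> because their norms agree, and fixes \<open>e\<close>, which is orthogonal to
  \<open>g - d\<close>.\<close>

lemma orthogonal_transformation_exists_fixing:
  fixes g d e :: "'a::euclidean_space"
  assumes "norm g = norm d" "g \<bullet> e = 0" "d \<bullet> e = 0"
  obtains f where "orthogonal_transformation f" "f g = d" "f e = e"
proof (cases "g = d")
  case True
  show ?thesis by (rule that[of id]) (simp_all add: True orthogonal_transformation linear_id)
next
  case False
  define c where "c = g - d"
  define f where "f x = x - (2 * (x \<bullet> c) / (c \<bullet> c)) *\<^sub>R c" for x
  have c: "c \<bullet> c \<noteq> 0" using False by (simp add: c_def)
  have "linear f"
    by (rule linearI) (simp_all add: f_def inner_add_left algebra_simps add_divide_distrib)
  moreover have "norm (f x) = norm x" for x
  proof -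
    have "f x \<bullet> f x = x \<bullet> x - 4 * (x \<bullet> c) * (x \<bullet> c) / (c \<bullet> c) + (2 * (x \<bullet> c) / (c \<bullet> c))\<^sup>2 * (c \<bullet> c)"
      by (simp add: f_def inner_diff_left inner_diff_right inner_commute power2_eq_square)
    also have "\<dots> = x \<bullet> x" using c by (simp add: power2_eq_square)
    finally show ?thesis by (simp add: norm_eq_sqrt_inner)
  qed
  ultimately have "orthogonal_transformation f" by (simp add: orthogonal_transformation)
  moreover have "f g = d"
  proof -
    have "g \<bullet> g = d \<bullet> d" using assms(1) by (simp add: norm_eq_sqrt_inner)
    hence "2 * (g \<bullet> c) = c \<bullet> c" by (simp add: c_def inner_diff_left inner_diff_right inner_commute)
    hence "f g = g - c" using c by (simp add: f_def)
    thus ?thesis by (simp add: c_def)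
  qed
  moreover have "f e = e" using assms by (simp add: f_def c_def inner_diff_right inner_commute)
  ultimately show ?thesis by (rule that)
qed

text \<open>Rotating \<open>n\<close> onto the axis \<open>k\<close> turns the functional that
  exposes \<open>v\<close> into a height function; a translation then brings \<open>v\<close> to
  \<open>p\<close>.\<close>

lemma exposed_vertex_copy:
  fixes K :: "(real^'n) set"
  assumes "v \<in> K" "n \<noteq> 0" "\<And>x. x \<in> K \<Longrightarrow> x \<noteq> v \<Longrightarrow> n \<bullet> v < n \<bullet> x" "p $ k = 0"
  shows "\<exists>h. rigid h \<and> (\<forall>y\<in>h ` K. 0 \<le> y $ k) \<and> {y \<in> h ` K. y $ k = 0} = {p}"
proof -
  obtain f where f: "orthogonal_transformation f" "f n = norm n *\<^sub>R axis k (1::real)"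
    using orthogonal_transformation_exists[of n "norm n *\<^sub>R axis k (1::real)"] by auto
  define h where "h x = (p - f v) + f x" for x
  have "n \<bullet> x - n \<bullet> v = norm n * h x $ k" for x
  proof -
    have "n \<bullet> x - n \<bullet> v = f n \<bullet> f x - f n \<bullet> f v"
      using f(1) by (simp add: orthogonal_transformation_def)
    also have "\<dots> = norm n * (f x $ k - f v $ k)"
      by (simp add: f(2) inner_axis' right_diff_distrib)
    finally show ?thesis by (simp add: h_def assms(4))
  qed
  note eq = this
  have pos: "h x $ k > 0" if "x \<in> K" "x \<noteq> v" for x
    using eq[of x] assms(2) assms(3)[OF that] by (smt (verit) norm_ge_zero mult_nonneg_nonpos)
  have v: "h v = p" by (simp add: h_def)
  have "rigid h" unfolding rigid_def h_def using f(1) by blast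
  moreover have "\<forall>y\<in>h ` K. 0 \<le> y $ k" using pos v assms(4) by (metis image_iff less_imp_le order_refl)
  moreover have "{y \<in> h ` K. y $ k = 0} = {p}"
    using pos v assms(1,4) by (auto simp: image_iff) (metis less_irrefl)
  ultimately show ?thesis by blast
qed

text \<open>A first rotation makes the functional \<open>m\<close> a height function. The edge is
  then horizontal, and a second one, fixing the axis, turns it into the direction
  \<open>d\<close>.\<close>

lemma exposed_edge_copy:
  fixes K :: "(real^'n) set"
  assumes "m \<noteq> 0" "\<And>x. x \<in> K \<Longrightarrow> m \<bullet> x \<le> m \<bullet> u" "{x \<in> K. m \<bullet> x = m \<bullet> u} = closed_segment u w"
    "q $ k = 0" "d $ k = 0" "norm d = dist u w"
  shows "\<exists>h. rigid h \<and> (\<forall>y\<in>h ` K. y $ k \<le> 0) \<and> {y \<in> h ` K. y $ k = 0} = closed_segment q (q + d)"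
proof -
  obtain f0 where f0: "orthogonal_transformation f0" "f0 m = norm m *\<^sub>R axis k (1::real)"
    using orthogonal_transformation_exists[of m "norm m *\<^sub>R axis k (1::real)"] by auto
  have "m \<bullet> w = m \<bullet> u" using assms(3) ends_in_segment(2)[of w u] by blast
  hence "f0 m \<bullet> f0 (w - u) = 0"
    using f0(1) by (simp add: orthogonal_transformation_def inner_diff_right)
  hence g: "f0 (w - u) \<bullet> axis k 1 = 0" using assms(1) by (simp add: f0(2) inner_commute)
  have "norm (f0 (w - u)) = norm d"
    using f0(1) assms(6) by (simp add: orthogonal_transformation_norm dist_norm norm_minus_commute)
  then obtain f1 where f1: "orthogonal_transformation f1" "f1 (f0 (w - u)) = d" "f1 (axis k 1) = axis k (1::real)"
    using orthogonal_transformation_exists_fixing[OF _ g, of d] assms(5) by (auto simp: inner_axis)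
  define f where "f = f1 \<circ> f0"
  have f: "orthogonal_transformation f" unfolding f_def
    using f0(1) f1(1) by (intro orthogonal_transformation_compose)
  have lin: "linear f" using f by (simp add: orthogonal_transformation_def)
  have fm: "f m = norm m *\<^sub>R axis k (1::real)" and fd: "f w = f u + d"
  proof -
    have "linear f1" using f1(1) by (simp add: orthogonal_transformation_def)
    thus "f m = norm m *\<^sub>R axis k 1" by (simp add: f_def f0(2) linear_scale f1(3))
    have "f (w - u) = d" using f1(2) by (simp add: f_def)
    thus "f w = f u + d" using lin by (simp add: linear_diff algebra_simps)
  qed
  define h where "h x = (q - f u) + f x" for x
  have eq: "m \<bullet> x - m \<bullet> u = norm m * h x $ k" for x
  proof -
    have "m \<bullet> x - m \<bullet> u = f m \<bullet> f x - f m \<bullet> f u"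
      using f by (simp add: orthogonal_transformation_def)
    also have "\<dots> = norm m * (f x $ k - f u $ k)"
      by (simp add: fm inner_axis' right_diff_distrib)
    finally show ?thesis by (simp add: h_def assms(4))
  qed
  have le: "h x $ k \<le> 0" if "x \<in> K" for x
  proof -
    have "norm m * h x $ k \<le> 0" using eq[of x] assms(2)[OF that] by linarith
    thus ?thesis using assms(1) by (simp add: mult_le_0_iff)
  qed
  have iff: "h x $ k = 0 \<longleftrightarrow> m \<bullet> x = m \<bullet> u" for x
  proof -
    have "h x $ k = 0 \<longleftrightarrow> m \<bullet> x - m \<bullet> u = 0" unfolding eq using assms(1) by simp
    thus ?thesis by simp
  qed
  have "{y \<in> h ` K. y $ k = 0} = h ` {x \<in> K. m \<bullet> x = m \<bullet> u}" using iff by blast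
  also have "\<dots> = (+) (q - f u) ` (f ` closed_segment u w)"
    unfolding assms(3) by (simp add: h_def image_image)
  also have "\<dots> = closed_segment ((q - f u) + f u) ((q - f u) + f w)"
    by (simp only: closed_segment_linear_image[OF lin] closed_segment_translation)
  also have "\<dots> = closed_segment q (q + d)" by (simp add: fd)
  finally have "{y \<in> h ` K. y $ k = 0} = closed_segment q (q + d)" .
  moreover have "rigid h" unfolding rigid_def h_def using f by blast
  ultimately show ?thesis using le by blast
qed

text \<open>A nonempty horizontal slice of a box contains three corners of a rectangle with positive
  sides, which no line of this form contains. It excludes cubes that happen to be
  axis-aligned.\<close>

lemma not_axis_aligned_box:
  fixes T :: "(real^3) set"
  assumes ne: "\<exists>y\<in>T. y $ 3 = 0"
    and line: "\<And>y. y \<in> T \<Longrightarrow> y $ 3 = 0 \<Longrightarrow> y $ 2 = m * y $ 1 + c"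
  shows "\<not> axis_aligned_box T"
proof
  assume "axis_aligned_box T"
  then obtain a b where ab: "\<And>i. a $ i < b $ i" and T: "T = cbox a b"
    unfolding axis_aligned_box_def by blast
  obtain y where "y \<in> T" "y $ 3 = 0" using ne by blast
  hence z: "a $ 3 \<le> 0" "0 \<le> b $ 3" unfolding T mem_box_cart by metis+
  have "vector [a $ 1, a $ 2, 0] \<in> T" "vector [b $ 1, a $ 2, 0] \<in> T" "vector [a $ 1, b $ 2, 0] \<in> T"
    using ab z by (auto simp: T mem_box_cart forall_3 less_imp_le)
  hence *: "a $ 2 = m * a $ 1 + c" "a $ 2 = m * b $ 1 + c" "b $ 2 = m * a $ 1 + c"
    using line by fastforce+
  hence "m * a $ 1 = m * b $ 1" by linarith
  hence "m = 0" using ab[of 1] by simp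
  thus False using * ab[of 2] by simp
qed

text \<open>Copies above and below the plane meet only in it, where one leaves a point and the other
  a segment. By \<open>long\<close> the segment, which starts at abscissa 0, reaches every point on
  its line.\<close>

lemma exists_touching_family:
  fixes P L :: "(nat \<times> nat) set" and K :: "(real^3) set"
  assumes fin: "finite P" "finite L"
    and vertex: "v \<in> K" "n \<noteq> 0" "\<And>x. x \<in> K \<Longrightarrow> x \<noteq> v \<Longrightarrow> n \<bullet> v < n \<bullet> x"
    and edge: "m \<noteq> 0" "\<And>x. x \<in> K \<Longrightarrow> m \<bullet> x \<le> m \<bullet> u" "{x \<in> K. m \<bullet> x = m \<bullet> u} = closed_segment u w" "u \<noteq> w"
    and long: "\<And>p l. p \<in> P \<Longrightarrow> l \<in> L \<Longrightarrow> real (fst p) * norm (vector [1, real (fst l), 0] :: real^3) \<le> dist u w"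
  shows "\<exists>F :: (real^3) set set. card F = card P + card L \<and>
    (\<forall>T\<in>F. (\<exists>h. rigid h \<and> T = h ` K) \<and> \<not> axis_aligned_box T) \<and>
    spanners_require 2 F ((card (incidences on_line P L) + 1) div 2)"
proof -
  define pt :: "nat \<times> nat \<Rightarrow> real^3" where "pt p = vector [real (fst p), real (snd p), 0]" for p
  define dir :: "nat \<times> nat \<Rightarrow> real^3" where "dir l = vector [1, real (fst l), 0]" for l
  \<comment> \<open>Since \<open>dir l\<close> has first coordinate 1, \<open>t l\<close> is the
    abscissa at which the segment ends.\<close>
  define t where "t l = dist u w / norm (dir l)" for l
  define q :: "nat \<times> nat \<Rightarrow> real^3" where "q l = vector [0, real (snd l), 0]" for l
  have dir0: "norm (dir l) > 0" for l
  proof -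
    have "dir l $ 1 \<noteq> 0" by (simp add: dir_def)
    hence "dir l \<noteq> 0" by (metis zero_index)
    thus ?thesis by simp
  qed
  have t0: "t l > 0" for l using dir0 edge(4) by (simp add: t_def)
  define S where "S l = closed_segment (q l) (q l + t l *\<^sub>R dir l)" for l
  have "\<exists>h. rigid h \<and> (\<forall>y\<in>h ` K. 0 \<le> y $ 3) \<and> {y \<in> h ` K. y $ 3 = 0} = {pt p}" for p
    by (rule exposed_vertex_copy[OF vertex]) (simp_all add: pt_def)
  hence "\<forall>p. \<exists>h. rigid h \<and> (\<forall>y\<in>h ` K. 0 \<le> y $ 3) \<and> {y \<in> h ` K. y $ 3 = 0} = {pt p}" by blast
  from choice[OF this] obtain h where
    "\<forall>p. rigid (h p) \<and> (\<forall>y\<in>h p ` K. 0 \<le> y $ 3) \<and> {y \<in> h p ` K. y $ 3 = 0} = {pt p}" ..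
  note h = conjunct1[OF spec[OF this]] conjunct1[OF conjunct2[OF spec[OF this]]]
    conjunct2[OF conjunct2[OF spec[OF this]]]
  have "\<exists>h. rigid h \<and> (\<forall>y\<in>h ` K. y $ 3 \<le> 0) \<and> {y \<in> h ` K. y $ 3 = 0} = S l" for l
    unfolding S_def
  proof (rule exposed_edge_copy[OF edge(1-3)])
    show "norm (t l *\<^sub>R dir l) = dist u w" using dir0[of l] by (simp add: t_def)
  qed (simp_all add: q_def dir_def)
  hence "\<forall>l. \<exists>h. rigid h \<and> (\<forall>y\<in>h ` K. y $ 3 \<le> 0) \<and> {y \<in> h ` K. y $ 3 = 0} = S l" by blast
  from choice[OF this] obtain g where
    "\<forall>l. rigid (g l) \<and> (\<forall>y\<in>g l ` K. y $ 3 \<le> 0) \<and> {y \<in> g l ` K. y $ 3 = 0} = S l" ..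
  note g = conjunct1[OF spec[OF this]] conjunct1[OF conjunct2[OF spec[OF this]]]
    conjunct2[OF conjunct2[OF spec[OF this]]]
  define \<phi> \<psi> where "\<phi> p = h p ` K" and "\<psi> l = g l ` K" for p l
  have \<phi>: "y \<in> \<phi> p \<and> y $ 3 = 0 \<longleftrightarrow> y = pt p" for y p using h(3) unfolding \<phi>_def by blast
  have \<psi>: "y \<in> \<psi> l \<and> y $ 3 = 0 \<longleftrightarrow> y \<in> S l" for y l using g(3) unfolding \<psi>_def by blast
  have S: "y \<in> S l \<longleftrightarrow> (\<exists>s. 0 \<le> s \<and> s \<le> t l \<and> y = vector [s, real (fst l) * s + real (snd l), 0])" for y l
  proof -
    have "y \<in> S l \<longleftrightarrow> (\<exists>x. 0 \<le> x \<and> x \<le> 1 \<and> y = vector [x * t l, real (fst l) * (x * t l) + real (snd l), 0])"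
      unfolding S_def closed_segment_def
      by (simp add: vec_eq_iff forall_3 q_def dir_def algebra_simps) blast
    also have "\<dots> \<longleftrightarrow> (\<exists>s. 0 \<le> s \<and> s \<le> t l \<and> y = vector [s, real (fst l) * s + real (snd l), 0])"
    proof safe
      fix x :: real assume "0 \<le> x" "x \<le> 1"
      thus "\<exists>s\<ge>0. s \<le> t l \<and> vector [x * t l, real (fst l) * (x * t l) + real (snd l), 0] =
          (vector [s, real (fst l) * s + real (snd l), 0] :: real^3)"
        using t0[of l] by (intro exI[of _ "x * t l"]) (simp add: mult_le_cancel_right1)
    next
      fix s :: real assume "0 \<le> s" "s \<le> t l"
      thus "\<exists>x\<ge>0. x \<le> 1 \<and> (vector [s, real (fst l) * s + real (snd l), 0] :: real^3) =
          vector [x * t l, real (fst l) * (x * t l) + real (snd l), 0]"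
        using t0[of l] by (intro exI[of _ "s / t l"]) simp
    qed
    finally show ?thesis .
  qed
  have inj_pt: "pt p = pt p' \<longleftrightarrow> p = p'" for p p'
    by (auto simp: pt_def vec_eq_iff forall_3 prod_eq_iff)
  have inj: "inj_on \<phi> P" by (rule inj_onI) (metis \<phi> inj_pt)
  have inj': "inj_on \<psi> L"
  proof (rule inj_onI)
    fix l l' assume "\<psi> l = \<psi> l'"
    hence eq: "S l = S l'" using \<psi> by (metis set_eqI)
    define s where "s = min (t l) (t l')"
    have "(vector [x, real (fst l) * x + real (snd l), 0] :: real^3) \<in> S l'" if "0 \<le> x" "x \<le> s" for x
      unfolding eq[symmetric] S using that by (auto simp: s_def)
    hence *: "real (fst l) * x + real (snd l) = real (fst l') * x + real (snd l')" if "0 \<le> x" "x \<le> s" for x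
      using that unfolding S by (fastforce simp: vec_eq_iff forall_3)
    have s: "s > 0" using t0 by (simp add: s_def)
    have "real (snd l) = real (snd l')" using *[of 0] s by simp
    moreover from this have "real (fst l) * s = real (fst l') * s" using *[of s] s by simp
    ultimately show "l = l'" using s by (simp add: prod_eq_iff)
  qed
  \<comment> \<open>One copy touches the plane in a single point, the other in a segment of positive
    length.\<close>
  have disj: "\<phi> p \<noteq> \<psi> l" for p l
  proof
    assume eq: "\<phi> p = \<psi> l"
    have "(vector [0, real (fst l) * 0 + real (snd l), 0] :: real^3) \<in> S l"
      "(vector [t l, real (fst l) * t l + real (snd l), 0] :: real^3) \<in> S l"
      unfolding S using t0[of l] by (auto intro: less_imp_le)
    hence "(vector [0, real (fst l) * 0 + real (snd l), 0] :: real^3) = vector [t l, real (fst l) * t l + real (snd l), 0]"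
      using \<phi> \<psi> eq by metis
    thus False using t0[of l] by (simp add: vec_eq_iff forall_3)
  qed
  have R: "meets (\<phi> p) (\<psi> l) \<longleftrightarrow> on_line p l" if "p \<in> P" "l \<in> L" for p l
  proof -
    have "meets (\<phi> p) (\<psi> l) \<longleftrightarrow> (\<exists>y. y \<in> \<phi> p \<and> y \<in> \<psi> l \<and> y $ 3 = 0)"
      using h(2) g(2) unfolding \<phi>_def \<psi>_def by (metis disjoint_iff order_antisym)
    also have "\<dots> \<longleftrightarrow> pt p \<in> S l" using \<phi> \<psi> by metis
    also have "\<dots> \<longleftrightarrow> (\<exists>s. 0 \<le> s \<and> s \<le> t l \<and> real (fst p) = s \<and> real (snd p) = real (fst l) * s + real (snd l))"
      unfolding S by (simp add: pt_def vec_eq_iff forall_3)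
    also have "\<dots> \<longleftrightarrow> real (snd p) = real (fst l * fst p + snd l)"
      using long[OF that] dir0[of l] by (auto simp: t_def dir_def field_simps)
    also have "\<dots> \<longleftrightarrow> on_line p l" unfolding on_line_def by (simp only: of_nat_eq_iff)
    finally show ?thesis .
  qed
  note result = spanners_require_2_incidences[where R = on_line and \<phi> = \<phi> and \<psi> = \<psi>,
      OF fin inj inj' disj R K22_free_on_line]
  have "\<not> axis_aligned_box (\<phi> p)" for p
  proof (rule not_axis_aligned_box[where m = 0 and c = "real (snd p)"])
    show "\<exists>y\<in>\<phi> p. y $ 3 = 0" using \<phi> by blast
    show "y $ 2 = 0 * y $ 1 + real (snd p)" if "y \<in> \<phi> p" "y $ 3 = 0" for y
    proof -
      have "y = pt p" using \<phi> that by blast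
      thus ?thesis by (simp add: pt_def)
    qed
  qed
  moreover have "\<not> axis_aligned_box (\<psi> l)" for l
  proof (rule not_axis_aligned_box[where m = "real (fst l)" and c = "real (snd l)"])
    have "q l \<in> S l" by (simp add: S_def)
    thus "\<exists>y\<in>\<psi> l. y $ 3 = 0" using \<psi> by blast
    show "y $ 2 = real (fst l) * y $ 1 + real (snd l)" if "y \<in> \<psi> l" "y $ 3 = 0" for y
    proof -
      have "y \<in> S l" using \<psi> that by blast
      thus ?thesis unfolding S by auto
    qed
  qed
  moreover have "\<exists>k. rigid k \<and> \<phi> p = k ` K" "\<exists>k. rigid k \<and> \<psi> l = k ` K" for p l
    unfolding \<phi>_def \<psi>_def using h(1) g(1) by blast+
  ultimately have "\<forall>T\<in>\<phi> ` P \<union> \<psi> ` L. (\<exists>k. rigid k \<and> T = k ` K) \<and> \<not> axis_aligned_box T"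
    by (simp only: ball_Un ball_simps) simp
  thus ?thesis using result by blast
qed

section \<open>Cubes and tetrahedra\<close>

lemma exists_length_bound:
  fixes P L :: "(nat \<times> nat) set" and f :: "nat \<times> nat \<Rightarrow> nat \<times> nat \<Rightarrow> real"
  assumes "finite P" "finite L"
  obtains s where "s \<ge> 1" "\<And>p l. p \<in> P \<Longrightarrow> l \<in> L \<Longrightarrow> f p l \<le> s"
proof -
  have "bdd_above ((\<lambda>(p, l). f p l) ` (P \<times> L))" using assms by (intro bdd_above_finite) auto
  then obtain M where M: "\<And>p l. p \<in> P \<Longrightarrow> l \<in> L \<Longrightarrow> f p l \<le> M"
    unfolding bdd_above_def by auto
  show ?thesis
    by (rule that[of "max 1 M"]) (use M in \<open>auto intro: max.coboundedI2\<close>)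
qed

text \<open>The cube of side \<open>s\<close> at the origin has its vertex 0 exposed by
  \<open>(1,1,1)\<close> and its edge on the third axis by \<open>(-1,-1,0)\<close>;
  \<open>s\<close> is chosen to satisfy the length condition.\<close>

lemma exists_hypercube_touching_family:
  fixes P L :: "(nat \<times> nat) set"
  assumes fin: "finite P" "finite L"
  shows "\<exists>F :: (real^3) set set. card F = card P + card L \<and>
    ((\<forall>Q\<in>F. hypercube Q \<and> \<not> axis_aligned_box Q) \<and> pairwise congruent_sets F) \<and>
    spanners_require 2 F ((card (incidences on_line P L) + 1) div 2)"
proof -
  obtain s where s: "s \<ge> 1"
    "\<And>p l. p \<in> P \<Longrightarrow> l \<in> L \<Longrightarrow> real (fst p) * norm (vector [1, real (fst l), 0] :: real^3) \<le> s"
    using exists_length_bound[OF fin, of "\<lambda>p l. real (fst p) * norm (vector [1, real (fst l), 0] :: real^3)"]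
    by blast
  define K :: "(real^3) set" where "K = cbox 0 (\<chi> i. s)"
  define w :: "real^3" where "w = vector [0, 0, s]"
  have K: "x \<in> K \<longleftrightarrow> (0 \<le> x $ 1 \<and> x $ 1 \<le> s) \<and> (0 \<le> x $ 2 \<and> x $ 2 \<le> s) \<and> (0 \<le> x $ 3 \<and> x $ 3 \<le> s)" for x
    by (simp add: K_def mem_box_cart forall_3)
  have inner3: "vector [a, b, c] \<bullet> x = a * x $ 1 + b * x $ 2 + c * x $ 3" for a b c and x :: "real^3"
    by (simp add: inner_vec_def sum_3)
  have seg: "{x \<in> K. vector [-1, -1, 0] \<bullet> x = vector [-1, -1, 0] \<bullet> (0 :: real^3)} = closed_segment 0 w"
  proof (intro set_eqI iffI)
    fix x assume "x \<in> {x \<in> K. vector [-1, -1, 0] \<bullet> x = vector [-1, -1, 0] \<bullet> (0 :: real^3)}"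
    hence x: "x \<in> K" "x $ 1 + x $ 2 = 0" by (auto simp: inner3)
    hence "x = (x $ 3 / s) *\<^sub>R w" "0 \<le> x $ 3 / s" "x $ 3 / s \<le> 1"
      using s by (auto simp: K w_def vec_eq_iff forall_3)
    thus "x \<in> closed_segment 0 w" unfolding closed_segment_def by force
  next
    fix x assume "x \<in> closed_segment 0 w"
    then obtain t where "0 \<le> t" "t \<le> 1" "x = t *\<^sub>R w" by (auto simp: closed_segment_def)
    moreover have "t * s \<le> s" using calculation s by (simp add: mult_left_le_one_le)
    ultimately show "x \<in> {x \<in> K. vector [-1, -1, 0] \<bullet> x = vector [-1, -1, 0] \<bullet> (0 :: real^3)}"
      using s by (simp add: K inner3 w_def)
  qed
  have "norm w = s" using s by (simp add: w_def norm_vec_def L2_set_def sum_3)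
  hence dist: "dist 0 w = s" by (simp add: dist_norm)
  have pos: "(vector [1, 1, 1] :: real^3) \<bullet> 0 < vector [1, 1, 1] \<bullet> x" if "x \<in> K" "x \<noteq> 0" for x
    using that by (auto simp: K inner3 vec_eq_iff forall_3)
  have neg: "(vector [-1, -1, 0] :: real^3) \<bullet> x \<le> vector [-1, -1, 0] \<bullet> 0" if "x \<in> K" for x
    using that by (simp add: K inner3)
  have nz: "(vector [1, 1, 1] :: real^3) \<noteq> 0" "(vector [-1, -1, 0] :: real^3) \<noteq> 0" "0 \<noteq> w"
    using s by (auto simp: w_def vec_eq_iff forall_3)
  have "0 \<in> K" using s by (simp add: K)
  hence "\<exists>F :: (real^3) set set. card F = card P + card L \<and>
      (\<forall>T\<in>F. (\<exists>h. rigid h \<and> T = h ` K) \<and> \<not> axis_aligned_box T) \<and>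
      spanners_require 2 F ((card (incidences on_line P L) + 1) div 2)"
    by (rule exists_touching_family[OF fin _ nz(1) _ nz(2) _ seg nz(3)])
      (erule (1) pos | erule neg | (unfold dist, erule (1) s(2)))+
  then obtain F :: "(real^3) set set" where F0: "card F = card P + card L \<and>
      (\<forall>T\<in>F. (\<exists>h. rigid h \<and> T = h ` K) \<and> \<not> axis_aligned_box T) \<and>
      spanners_require 2 F ((card (incidences on_line P L) + 1) div 2)" ..
  note F = conjunct1[OF F0] conjunct1[OF bspec[OF conjunct1[OF conjunct2[OF F0]]]]
    conjunct2[OF bspec[OF conjunct1[OF conjunct2[OF F0]]]] conjunct2[OF conjunct2[OF F0]]
  have "axis_aligned_hypercube K"
    unfolding axis_aligned_hypercube_def K_def using s by (intro exI[of _ 0] exI[of _ s]) simp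
  hence "hypercube T" if "T \<in> F" for T
    unfolding hypercube_def congruent_sets_def using F(2)[OF that] rigid_dist by blast
  moreover have "pairwise congruent_sets F"
    unfolding pairwise_def using F(2) congruent_sets_rigid_images by metis
  ultimately show ?thesis using F by blast
qed

section \<open>Tetrahedra as hulls of four points\<close>

lemma convex_hull_4E:
  assumes "x \<in> convex hull {p, a, b, c}"
  obtains k1 k2 k3 k4 where "0 \<le> k1" "0 \<le> k2" "0 \<le> k3" "0 \<le> k4" "k1 + k2 + k3 + k4 = 1"
    "x = k1 *\<^sub>R p + k2 *\<^sub>R a + k3 *\<^sub>R b + k4 *\<^sub>R c"
proof -
  obtain u v y where uv: "0 \<le> u" "0 \<le> v" "u + v = 1" "y \<in> convex hull {a, b, c}" "x = u *\<^sub>R p + v *\<^sub>R y"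
    using assms by (auto simp: convex_hull_insert[of "{a, b, c}"])
  then obtain k2 k3 k4 where k: "0 \<le> k2" "0 \<le> k3" "0 \<le> k4" "k2 + k3 + k4 = 1"
    "y = k2 *\<^sub>R a + k3 *\<^sub>R b + k4 *\<^sub>R c" by (auto simp: convex_hull_3)
  have "u + v * k2 + v * k3 + v * k4 = u + v * (k2 + k3 + k4)" by (simp add: algebra_simps)
  hence "u + v * k2 + v * k3 + v * k4 = 1" using uv(3) k(4) by simp
  moreover have "x = u *\<^sub>R p + (v * k2) *\<^sub>R a + (v * k3) *\<^sub>R b + (v * k4) *\<^sub>R c"
    by (simp add: uv(5) k(5) algebra_simps)
  ultimately show ?thesis using that[of u "v * k2" "v * k3" "v * k4"] uv(1,2) k(1-3) by simp
qed

lemma affine_independent_4: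
  fixes p e g k :: "'a::real_vector"
  assumes ind: "\<And>\<alpha> \<beta> \<gamma>. \<alpha> *\<^sub>R e + \<beta> *\<^sub>R g + \<gamma> *\<^sub>R k = 0 \<Longrightarrow> \<alpha> = 0 \<and> \<beta> = 0 \<and> \<gamma> = 0"
  shows "\<not> affine_dependent {p, p + e, p + g, p + k}" "card {p, p + e, p + g, p + k} = 4"
proof -
  have ne: "e \<noteq> 0" "g \<noteq> 0" "k \<noteq> 0" "e \<noteq> g" "e \<noteq> k" "g \<noteq> k"
    using ind[of 1 0 0] ind[of 0 1 0] ind[of 0 0 1] ind[of 1 "-1" 0] ind[of 1 0 "-1"] ind[of 0 1 "-1"]
    by auto
  show "card {p, p + e, p + g, p + k} = 4" using ne by simp
  show "\<not> affine_dependent {p, p + e, p + g, p + k}"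
  proof
    assume "affine_dependent {p, p + e, p + g, p + k}"
    then obtain u where u: "sum u {p, p + e, p + g, p + k} = 0" "\<exists>v\<in>{p, p + e, p + g, p + k}. u v \<noteq> 0"
      "(\<Sum>v\<in>{p, p + e, p + g, p + k}. u v *\<^sub>R v) = 0"
      by (auto simp: affine_dependent_explicit_finite)
    have s: "u p + u (p + e) + u (p + g) + u (p + k) = 0" using u(1) ne by (simp add: add.assoc)
    have "u p *\<^sub>R p + u (p + e) *\<^sub>R (p + e) + u (p + g) *\<^sub>R (p + g) + u (p + k) *\<^sub>R (p + k) = 0"
      using u(3) ne by (simp add: add.assoc)
    hence "(u p + u (p + e) + u (p + g) + u (p + k)) *\<^sub>R p
        + (u (p + e) *\<^sub>R e + u (p + g) *\<^sub>R g + u (p + k) *\<^sub>R k) = 0"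
      by (simp add: algebra_simps)
    hence "u (p + e) = 0 \<and> u (p + g) = 0 \<and> u (p + k) = 0" unfolding s using ind by simp
    thus False using s u(2) by auto
  qed
qed

text \<open>The vertices are alternate corners of a cube of side \<open>s\<close>, so all edges have
  length \<open>sqrt 2 * s\<close>. The functional \<open>(1,1,1)\<close> exposes the vertex 0, and
  \<open>(0,0,-1)\<close> the edge from 0 to \<open>a\<close>.\<close>

lemma exists_regular_tetrahedron_family:
  fixes P L :: "(nat \<times> nat) set"
  assumes fin: "finite P" "finite L"
  shows "\<exists>F :: (real^3) set set. card F = card P + card L \<and>
    ((\<forall>T\<in>F. regular_tetrahedron T) \<and> pairwise congruent_sets F) \<and>
    spanners_require 2 F ((card (incidences on_line P L) + 1) div 2)"
proof -
  obtain s where s: "s \<ge> 1"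
    "\<And>p l. p \<in> P \<Longrightarrow> l \<in> L \<Longrightarrow> real (fst p) * norm (vector [1, real (fst l), 0] :: real^3) \<le> s"
    using exists_length_bound[OF fin, of "\<lambda>p l. real (fst p) * norm (vector [1, real (fst l), 0] :: real^3)"]
    by blast
  define a b c :: "real^3" where "a = vector [s, s, 0]" and "b = vector [s, 0, s]" and "c = vector [0, s, s]"
  define C where "C = {0, a, b, c}"
  define K where "K = convex hull C"
  have inner3: "vector [k1, k2, k3] \<bullet> x = k1 * x $ 1 + k2 * x $ 2 + k3 * x $ 3" for k1 k2 k3 and x :: "real^3"
    by (simp add: inner_vec_def sum_3)
  have K: "\<exists>k1 k2 k3. 0 \<le> k1 \<and> 0 \<le> k2 \<and> 0 \<le> k3 \<and> k1 + k2 + k3 \<le> 1 \<and> x = k1 *\<^sub>R a + k2 *\<^sub>R b + k3 *\<^sub>R c"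
    if xK: "x \<in> K" for x
  proof -
    obtain k0 k1 k2 k3 where "0 \<le> k0" "0 \<le> k1" "0 \<le> k2" "0 \<le> k3" "k0 + k1 + k2 + k3 = 1"
      "x = k0 *\<^sub>R 0 + k1 *\<^sub>R a + k2 *\<^sub>R b + k3 *\<^sub>R c"
      using convex_hull_4E[OF xK[unfolded K_def C_def]] by blast
    thus ?thesis by (intro exI[of _ k1] exI[of _ k2] exI[of _ k3]) simp
  qed
  have CK: "C \<subseteq> K" by (simp add: K_def hull_subset)
  have seg: "{x \<in> K. vector [0, 0, -1] \<bullet> x = vector [0, 0, -1] \<bullet> (0 :: real^3)} = closed_segment 0 a"
  proof (intro set_eqI iffI)
    fix x assume "x \<in> {x \<in> K. vector [0, 0, -1] \<bullet> x = vector [0, 0, -1] \<bullet> (0 :: real^3)}"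
    hence x: "x \<in> K" "x $ 3 = 0" by (auto simp: inner3)
    obtain k1 k2 k3 where k: "0 \<le> k1" "0 \<le> k2" "0 \<le> k3" "k1 + k2 + k3 \<le> 1"
      "x = k1 *\<^sub>R a + k2 *\<^sub>R b + k3 *\<^sub>R c" using K[OF x(1)] by blast
    hence "k2 * s + k3 * s = 0" using x(2) by (simp add: a_def b_def c_def)
    hence "(k2 + k3) * s = 0" by (simp add: algebra_simps)
    hence "k2 = 0 \<and> k3 = 0" using s k by auto
    hence "x = k1 *\<^sub>R a" "k1 \<le> 1" using k by simp_all
    thus "x \<in> closed_segment 0 a" using k(1) unfolding closed_segment_def by force
  next
    fix x assume x: "x \<in> closed_segment 0 a"
    have "closed_segment 0 a \<subseteq> K"
      using CK by (intro closed_segment_subset) (auto simp: C_def K_def)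
    moreover have "x $ 3 = 0" using x by (auto simp: closed_segment_def a_def)
    ultimately show "x \<in> {x \<in> K. vector [0, 0, -1] \<bullet> x = vector [0, 0, -1] \<bullet> (0 :: real^3)}"
      using x by (auto simp: inner3)
  qed
  have norms: "norm a = sqrt 2 * s" "norm b = sqrt 2 * s" "norm c = sqrt 2 * s"
    "norm (a - b) = sqrt 2 * s" "norm (a - c) = sqrt 2 * s" "norm (b - c) = sqrt 2 * s"
    using s by (simp_all add: a_def b_def c_def norm_vec_def L2_set_def sum_3 real_sqrt_mult)
  have dist: "dist 0 a = sqrt 2 * s" using norms by (simp add: dist_norm)
  have long: "real (fst p) * norm (vector [1, real (fst l), 0] :: real^3) \<le> sqrt 2 * s"
    if "p \<in> P" "l \<in> L" for p l
  proof -
    have "s \<le> sqrt 2 * s" using s by simp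
    thus ?thesis using s(2)[OF that] by linarith
  qed
  have pos: "(vector [1, 1, 1] :: real^3) \<bullet> 0 < vector [1, 1, 1] \<bullet> x" if xK: "x \<in> K" "x \<noteq> 0" for x
  proof -
    obtain k1 k2 k3 where k: "0 \<le> k1" "0 \<le> k2" "0 \<le> k3" "x = k1 *\<^sub>R a + k2 *\<^sub>R b + k3 *\<^sub>R c"
      using K[OF xK(1)] by blast
    have "k1 + k2 + k3 \<noteq> 0"
    proof
      assume "k1 + k2 + k3 = 0"
      hence "k1 = 0" "k2 = 0" "k3 = 0" using k by linarith+
      thus False using xK k by simp
    qed
    hence "0 < 2 * s * (k1 + k2 + k3)" using s k by simp
    also have "\<dots> = vector [1, 1, 1] \<bullet> x" unfolding inner3 k(4) by (simp add: a_def b_def c_def algebra_simps)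
    finally show ?thesis by simp
  qed
  have neg: "(vector [0, 0, -1] :: real^3) \<bullet> x \<le> vector [0, 0, -1] \<bullet> 0" if xK: "x \<in> K" for x
  proof -
    obtain k1 k2 k3 where k: "0 \<le> k1" "0 \<le> k2" "0 \<le> k3" "x = k1 *\<^sub>R a + k2 *\<^sub>R b + k3 *\<^sub>R c"
      using K[OF xK(1)] by blast
    have "0 \<le> k2 * s + k3 * s" using s(1) k by simp
    thus ?thesis unfolding k(4) inner3 by (simp add: a_def b_def c_def)
  qed
  have nz: "(vector [1, 1, 1] :: real^3) \<noteq> 0" "(vector [0, 0, -1] :: real^3) \<noteq> 0" "0 \<noteq> a"
    using s by (auto simp: a_def vec_eq_iff forall_3)
  have "0 \<in> K" using CK by (simp add: C_def)
  hence "\<exists>F :: (real^3) set set. card F = card P + card L \<and>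
      (\<forall>T\<in>F. (\<exists>h. rigid h \<and> T = h ` K) \<and> \<not> axis_aligned_box T) \<and>
      spanners_require 2 F ((card (incidences on_line P L) + 1) div 2)"
    by (rule exists_touching_family[OF fin _ nz(1) _ nz(2) _ seg nz(3)])
      (erule (1) pos | erule neg | (unfold dist, erule (1) long))+
  then obtain F :: "(real^3) set set" where F0: "card F = card P + card L \<and>
      (\<forall>T\<in>F. (\<exists>h. rigid h \<and> T = h ` K) \<and> \<not> axis_aligned_box T) \<and>
      spanners_require 2 F ((card (incidences on_line P L) + 1) div 2)" ..
  note F = conjunct1[OF F0] conjunct1[OF bspec[OF conjunct1[OF conjunct2[OF F0]]]]
    conjunct2[OF bspec[OF conjunct1[OF conjunct2[OF F0]]]] conjunct2[OF conjunct2[OF F0]]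
  have "regular_tetrahedron T" if "T \<in> F" for T
  proof -
    obtain h f q where h: "T = h ` K" "orthogonal_transformation f" "h = (\<lambda>x. q + f x)"
      using F(2)[OF \<open>T \<in> F\<close>] by (auto simp: rigid_def)
    have lin: "linear f" using h(2) by (simp add: orthogonal_transformation_def)
    have "h ` C = {q, q + f a, q + f b, q + f c}" by (simp add: C_def h(3) linear_0[OF lin])
    moreover have "\<alpha> = 0 \<and> \<beta> = 0 \<and> \<gamma> = 0" if "\<alpha> *\<^sub>R f a + \<beta> *\<^sub>R f b + \<gamma> *\<^sub>R f c = 0" for \<alpha> \<beta> \<gamma>
    proof -
      have "f (\<alpha> *\<^sub>R a + \<beta> *\<^sub>R b + \<gamma> *\<^sub>R c) = 0"
        using that lin by (simp add: linear_add linear_scale)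
      hence "norm (\<alpha> *\<^sub>R a + \<beta> *\<^sub>R b + \<gamma> *\<^sub>R c) = 0"
        using orthogonal_transformation_norm[OF h(2)] by (metis norm_zero)
      hence "\<alpha> *\<^sub>R a + \<beta> *\<^sub>R b + \<gamma> *\<^sub>R c = 0" by simp
      hence "\<alpha> * s + \<beta> * s = 0" "\<alpha> * s + \<gamma> * s = 0" "\<beta> * s + \<gamma> * s = 0"
        by (simp_all add: a_def b_def c_def vec_eq_iff forall_3)
      hence "(\<alpha> + \<beta>) * s = 0" "(\<alpha> + \<gamma>) * s = 0" "(\<beta> + \<gamma>) * s = 0" by (simp_all add: algebra_simps)
      hence "\<alpha> + \<beta> = 0" "\<alpha> + \<gamma> = 0" "\<beta> + \<gamma> = 0" using s by simp_all
      thus ?thesis by linarith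
    qed
    ultimately have "\<not> affine_dependent (h ` C)" "card (h ` C) = 4"
      using affine_independent_4[of "f a" "f b" "f c" q] by simp_all
    moreover have "T = convex hull (h ` C)"
    proof -
      have "T = (+) q ` (f ` (convex hull C))" by (simp add: h(1,3) K_def image_image)
      also have "\<dots> = convex hull ((+) q ` (f ` C))"
        by (simp only: convex_hull_linear_image[OF lin] convex_hull_translation)
      finally show ?thesis by (simp add: h(3) image_image)
    qed
    moreover have "dist x y = sqrt 2 * s" if xyC: "x \<in> h ` C" "y \<in> h ` C" "x \<noteq> y" for x y
    proof -
      obtain x0 y0 where xy: "x = h x0" "y = h y0" "x0 \<in> C" "y0 \<in> C" "x0 \<noteq> y0" using xyC by blast
      hence "dist x y = norm (x0 - y0)"
        using orthogonal_transformation_dist[OF h(2)] by (simp add: h(3) dist_norm[symmetric])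
      also have "\<dots> = sqrt 2 * s" using xy(3-5) norms by (auto simp: C_def norm_minus_commute)
      finally show ?thesis .
    qed
    ultimately show ?thesis unfolding regular_tetrahedron_def by blast
  qed
  moreover have "pairwise congruent_sets F"
    unfolding pairwise_def using F(2) congruent_sets_rigid_images by metis
  ultimately show ?thesis using F by blast
qed

section \<open>Thin tetrahedra\<close>

text \<open>Two further vertices are moved off \<open>u\<close> by \<open>\<epsilon> / 2\<close>
  along axes other than one in which the segment has a nonzero component, so the edge vectors are
  independent. Convex combinations leave the segment by at most
  \<open>\<epsilon> / 2\<close>.\<close>

lemma exists_thin_tetrahedron:
  fixes u w :: "real^3"
  assumes "u \<noteq> w" "\<epsilon> > 0"
  shows "\<exists>T. tetrahedron T \<and> closed_segment u w \<subseteq> T \<and> (\<forall>x\<in>T. \<exists>y\<in>closed_segment u w. dist x y < \<epsilon>)"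
proof -
  define d where "d = w - u"
  have "d \<noteq> 0" using assms by (simp add: d_def)
  then obtain i where i: "d $ i \<noteq> 0" by (metis vec_eq_iff zero_index)
  have "i = 1 \<or> i = 2 \<or> i = 3" by (rule exhaust_3)
  \<comment> \<open>Index arithmetic is modulo 3, so \<open>i + 1\<close> and \<open>i + 2\<close>
    are the other two indices.\<close>
  hence "\<exists>j l. j \<noteq> i \<and> l \<noteq> i \<and> j \<noteq> l"
    by (elim disjE; intro exI[of _ "i + 1"] exI[of _ "i + 2"]; simp)
  then obtain j l where jl: "j \<noteq> i" "l \<noteq> i" "j \<noteq> l" by blast
  define g k :: "real^3" where "g = axis j (\<epsilon> / 2)" and "k = axis l (\<epsilon> / 2)"
  have norms: "norm g = \<epsilon> / 2" "norm k = \<epsilon> / 2" using assms by (simp_all add: g_def k_def norm_eq_sqrt_inner inner_axis_axis real_sqrt_divide)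
  have "\<alpha> = 0 \<and> \<beta> = 0 \<and> \<gamma> = 0" if eq: "\<alpha> *\<^sub>R d + \<beta> *\<^sub>R g + \<gamma> *\<^sub>R k = 0" for \<alpha> \<beta> \<gamma>
  proof -
    have c: "\<alpha> * d $ n + \<beta> * g $ n + \<gamma> * k $ n = 0" for n
      using arg_cong[OF eq, of "\<lambda>v. v $ n"] by simp
    have "\<alpha> = 0" using c[of i] i jl by (simp add: g_def k_def axis_def)
    moreover have "\<beta> = 0" using c[of j] jl assms calculation by (simp add: g_def k_def axis_def)
    moreover have "\<gamma> = 0" using c[of l] jl assms calculation by (simp add: g_def k_def axis_def)
    ultimately show ?thesis by simp
  qed
  note aff = affine_independent_4[of d g k u, OF this]
  define T where "T = convex hull {u, u + d, u + g, u + k}"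
  have "tetrahedron T"
    unfolding tetrahedron_def simplex_def T_def using aff by (intro exI[of _ "{u, u + d, u + g, u + k}"]) auto
  moreover have "closed_segment u w \<subseteq> T"
    unfolding segment_convex_hull T_def d_def by (rule hull_mono) auto
  moreover have "\<exists>y\<in>closed_segment u w. dist x y < \<epsilon>" if xT: "x \<in> T" for x
  proof -
    obtain k1 k2 k3 k4 where k: "0 \<le> k1" "0 \<le> k2" "0 \<le> k3" "0 \<le> k4" "k1 + k2 + k3 + k4 = 1"
      "x = k1 *\<^sub>R u + k2 *\<^sub>R (u + d) + k3 *\<^sub>R (u + g) + k4 *\<^sub>R (u + k)"
      using convex_hull_4E[OF xT[unfolded T_def]] by blast
    have "x = (k1 + k2 + k3 + k4) *\<^sub>R u + k2 *\<^sub>R d + (k3 *\<^sub>R g + k4 *\<^sub>R k)"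
      by (simp add: k(6) algebra_simps)
    hence x: "x = (u + k2 *\<^sub>R d) + (k3 *\<^sub>R g + k4 *\<^sub>R k)" by (simp add: k(5))
    have "norm (k3 *\<^sub>R g + k4 *\<^sub>R k) \<le> k3 * (\<epsilon> / 2) + k4 * (\<epsilon> / 2)"
      using norm_triangle_ineq[of "k3 *\<^sub>R g" "k4 *\<^sub>R k"] k norms by simp
    also have "\<dots> = (k3 + k4) * (\<epsilon> / 2)" by (simp add: algebra_simps)
    also have "\<dots> \<le> 1 * (\<epsilon> / 2)" using k assms by (intro mult_right_mono) auto
    also have "\<dots> < \<epsilon>" using assms by simp
    finally have "dist x (u + k2 *\<^sub>R d) < \<epsilon>" by (simp add: x dist_norm)
    moreover have "u + k2 *\<^sub>R d = (1 - k2) *\<^sub>R u + k2 *\<^sub>R w" by (simp add: d_def algebra_simps)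
    hence "u + k2 *\<^sub>R d \<in> closed_segment u w"
      unfolding closed_segment_def using k by (intro CollectI exI[of _ k2]) simp
    ultimately show ?thesis by blast
  qed
  ultimately show ?thesis by blast
qed

text \<open>Compactness gives each disjoint pair a positive gap, and finitely many gaps have a
  positive minimum.\<close>

lemma finite_separation:
  fixes \<P> :: "('a::heine_borel set \<times> 'a set) set"
  assumes "finite \<P>" "\<And>X Y. (X, Y) \<in> \<P> \<Longrightarrow> compact X \<and> compact Y \<and> X \<inter> Y = {}"
  shows "\<exists>\<epsilon>>0. \<forall>(X, Y)\<in>\<P>. \<forall>x\<in>X. \<forall>y\<in>Y. \<epsilon> \<le> dist x y"
  using assms
proof (induction \<P> rule: finite_induct)
  case empty
  show ?case by (intro exI[of _ 1]) simp
next
  case (insert p \<P>)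
  obtain X Y where p: "p = (X, Y)" by (cases p)
  obtain e where e: "e > 0" "\<forall>(X, Y)\<in>\<P>. \<forall>x\<in>X. \<forall>y\<in>Y. e \<le> dist x y"
    using insert by auto
  obtain d where d: "d > 0" "\<forall>x\<in>X. \<forall>y\<in>Y. d \<le> dist x y"
    using separate_compact_closed[of X Y] insert.prems[of X Y] p compact_imp_closed by blast
  have "\<forall>(X, Y)\<in>insert p \<P>. \<forall>x\<in>X. \<forall>y\<in>Y. min d e \<le> dist x y"
    using d e by (auto simp: p min_le_iff_disj)
  then show ?case using d(1) e(1) by (intro exI[of _ "min d e"]) simp
qed

lemma exists_tetrahedron_family:
  fixes P L :: "(nat \<times> nat) set"
  assumes fin: "finite P" "finite L"
  shows "\<exists>F :: (real^3) set set. card F = card P + card L \<and> (\<forall>T\<in>F. tetrahedron T) \<and>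
    spanners_require 3 F ((card (incidences on_line P L) + 1) div 2)"
proof -
  obtain j where j: "bij_betw j L {0..<card L}" using ex_bij_betw_finite_nat[OF fin(2)] by blast
  obtain X where X: "X \<ge> 1" "\<And>p l. p \<in> P \<Longrightarrow> l \<in> L \<Longrightarrow> real (fst p) \<le> X"
    using exists_length_bound[OF fin, of "\<lambda>p l. real (fst p)"] by blast
  \<comment> \<open>The lines lie at the distinct heights \<open>j l\<close> from 0 on, which makes
    them disjoint. The verticals start below them at height -1; this free end later distinguishes
    the two kinds of tetrahedra.\<close>
  define u0 u1 v0 v1 :: "nat \<times> nat \<Rightarrow> real^3" where
    "u0 p = vector [real (fst p), real (snd p), -1]" and
    "u1 p = vector [real (fst p), real (snd p), real (card L)]" and
    "v0 l = vector [0, real (snd l), real (j l)]" and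
    "v1 l = vector [X, real (fst l) * X + real (snd l), real (j l)]" for p l
  define A B where "A p = closed_segment (u0 p) (u1 p)" and "B l = closed_segment (v0 l) (v1 l)" for p l
  have A: "x $ 1 = real (fst p) \<and> x $ 2 = real (snd p)" if "x \<in> A p" for x p
  proof -
    from that obtain t where x: "x = (1 - t) *\<^sub>R u0 p + t *\<^sub>R u1 p"
      unfolding A_def closed_segment_def by blast
    show ?thesis unfolding x by (simp add: u0_def u1_def algebra_simps)
  qed
  have B: "x $ 2 = real (fst l) * x $ 1 + real (snd l) \<and> x $ 3 = real (j l)" if "x \<in> B l" for x l
  proof -
    from that obtain t where x: "x = (1 - t) *\<^sub>R v0 l + t *\<^sub>R v1 l"
      unfolding B_def closed_segment_def by blast
    show ?thesis unfolding x by (simp add: v0_def v1_def algebra_simps)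
  qed
  have A': "vector [real (fst p), real (snd p), h] \<in> A p" if "0 \<le> h" "h \<le> real (card L)" for p h
  proof -
    let ?t = "(h + 1) / (real (card L) + 1)"
    have t: "0 \<le> ?t" "?t \<le> 1" "?t * (real (card L) + 1) = h + 1" using that by (simp_all add: add_nonneg_eq_0_iff)
    have "(1 - ?t) * (-1) + ?t * real (card L) = ?t * (real (card L) + 1) - 1"
      by (simp only: algebra_simps)
    hence "(1 - ?t) * (-1) + ?t * real (card L) = h" by (simp only: t(3))
    hence "vector [real (fst p), real (snd p), h] = (1 - ?t) *\<^sub>R u0 p + ?t *\<^sub>R u1 p"
      by (simp only: vec_eq_iff forall_3 u0_def u1_def vector_3 vector_add_component vector_scaleR_component)
        (simp add: algebra_simps)
    thus ?thesis unfolding A_def closed_segment_def using t by blast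
  qed
  have B': "vector [h, real (fst l) * h + real (snd l), real (j l)] \<in> B l" if "0 \<le> h" "h \<le> X" for l h
  proof -
    have t: "0 \<le> h / X" "h / X \<le> 1" "h / X * X = h" using that X by simp_all
    hence "vector [h, real (fst l) * h + real (snd l), real (j l)] = (1 - h / X) *\<^sub>R v0 l + (h / X) *\<^sub>R v1 l"
      using X(1) by (simp add: vec_eq_iff forall_3 v0_def v1_def field_simps)
    thus ?thesis unfolding B_def closed_segment_def using t by blast
  qed
  have jL: "j l < card L" if "l \<in> L" for l using bij_betwE[OF j] that by auto
  have R: "meets (A p) (B l) \<longleftrightarrow> on_line p l" if "p \<in> P" "l \<in> L" for p l
  proof
    assume "meets (A p) (B l)"
    then obtain x where "x \<in> A p" "x \<in> B l" by blast
    hence "real (snd p) = real (fst l * fst p + snd l)" using A B by fastforce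
    thus "on_line p l" unfolding on_line_def by (simp only: of_nat_eq_iff)
  next
    assume "on_line p l"
    hence "real (snd p) = real (fst l) * real (fst p) + real (snd l)" by (simp add: on_line_def)
    hence "vector [real (fst p), real (snd p), real (j l)] \<in> A p \<inter> B l"
      using A'[of "real (j l)" p] B'[of "real (fst p)" l] X(2)[OF that] jL[OF that(2)] by simp
    thus "meets (A p) (B l)" by blast
  qed
  have dA: "A p \<inter> A p' = {}" if "p \<noteq> p'" for p p'
  proof (rule ccontr)
    assume "meets (A p) (A p')"
    then obtain x where "x \<in> A p" "x \<in> A p'" by blast
    hence "real (fst p) = real (fst p')" "real (snd p) = real (snd p')" using A by metis+
    thus False using that by (simp add: prod_eq_iff)
  qed
  have dB: "B l \<inter> B l' = {}" if "l \<in> L" "l' \<in> L" "l \<noteq> l'" for l l'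
  proof (rule ccontr)
    assume "meets (B l) (B l')"
    then obtain x where "x \<in> B l" "x \<in> B l'" by blast
    hence "real (j l) = real (j l')" using B by metis
    thus False using that j by (auto simp: bij_betw_def inj_on_def)
  qed
  have bottom: "{u0 p} \<inter> B l = {}" for p l
  proof (rule ccontr)
    assume "meets {u0 p} (B l)"
    hence "u0 p $ 3 = real (j l)" using B by blast
    thus False by (simp add: u0_def)
  qed
  \<comment> \<open>These are the pairs whose disjointness must survive the thickening. The
    singletons of lower ends serve only to show that no body arises both from a point and from a
    line.\<close>
  define \<P> where "\<P> = {(X, Y). X \<in> A ` P \<union> B ` L \<union> (\<lambda>p. {u0 p}) ` P \<and> Y \<in> A ` P \<union> B ` L \<and> X \<inter> Y = {}}"
  have "finite \<P>"
    by (rule finite_subset[of _ "(A ` P \<union> B ` L \<union> (\<lambda>p. {u0 p}) ` P) \<times> (A ` P \<union> B ` L)"])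
      (use fin in \<open>auto simp: \<P>_def\<close>)
  moreover have "compact X \<and> compact Y \<and> X \<inter> Y = {}" if "(X, Y) \<in> \<P>" for X Y
    using that by (auto simp: \<P>_def A_def B_def)
  ultimately have "\<exists>\<epsilon>>0. \<forall>(X, Y)\<in>\<P>. \<forall>x\<in>X. \<forall>y\<in>Y. \<epsilon> \<le> dist x y" by (rule finite_separation)
  then obtain \<epsilon> where \<epsilon>: "\<epsilon> > 0" "\<And>X Y x y. (X, Y) \<in> \<P> \<Longrightarrow> x \<in> X \<Longrightarrow> y \<in> Y \<Longrightarrow> \<epsilon> \<le> dist x y"
    by fast
  define near where "near S T \<longleftrightarrow> tetrahedron T \<and> S \<subseteq> T \<and> (\<forall>x\<in>T. \<exists>y\<in>S. dist x y < \<epsilon> / 2)"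
    for S T :: "(real^3) set"
  have "u0 p \<noteq> u1 p" for p by (simp add: u0_def u1_def vec_eq_iff forall_3)
  hence "\<exists>T. near (A p) T" for p
    unfolding near_def A_def using exists_thin_tetrahedron[of _ _ "\<epsilon> / 2"] \<epsilon>(1) by simp
  then obtain \<phi> where \<phi>: "\<And>p. near (A p) (\<phi> p)" by metis
  have "v0 l \<noteq> v1 l" for l using X(1) by (simp add: v0_def v1_def vec_eq_iff forall_3)
  hence "\<exists>T. near (B l) T" for l
    unfolding near_def B_def using exists_thin_tetrahedron[of _ _ "\<epsilon> / 2"] \<epsilon>(1) by simp
  then obtain \<psi> where \<psi>: "\<And>l. near (B l) (\<psi> l)" by metis
  \<comment> \<open>Each body stays within \<open>\<epsilon> / 2\<close> of its segment, so a common
    point would bring the segments closer than \<open>\<epsilon>\<close>.\<close>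
  have apart: "S' \<inter> T' = {}" if st: "(S, T) \<in> \<P>" "near S S'" "near T T'" for S T S' T'
  proof (rule ccontr)
    assume "meets S' T'"
    then obtain z where "z \<in> S'" "z \<in> T'" by blast
    then obtain x y where xy: "x \<in> S" "dist z x < \<epsilon> / 2" "y \<in> T" "dist z y < \<epsilon> / 2"
      using st unfolding near_def by meson
    have "\<epsilon> \<le> dist x y" using \<epsilon>(2) st(1) xy by blast
    thus False using dist_triangle3[of x y z] xy by (simp add: dist_commute)
  qed
  have ne: "\<phi> p \<noteq> {}" "\<psi> l \<noteq> {}" for p l
    using \<phi>[of p] \<psi>[of l] unfolding near_def A_def B_def by (metis ends_in_segment(1) empty_iff subset_empty)+
  have dA': "\<phi> p \<inter> \<phi> p' = {}" if "p \<in> P" "p' \<in> P" "p \<noteq> p'" for p p'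
    by (rule apart[OF _ \<phi> \<phi>]) (use dA that in \<open>simp add: \<P>_def\<close>)
  have dB': "\<psi> l \<inter> \<psi> l' = {}" if "l \<in> L" "l' \<in> L" "l \<noteq> l'" for l l'
    by (rule apart[OF _ \<psi> \<psi>]) (use dB that in \<open>simp add: \<P>_def\<close>)
  have R': "meets (\<phi> p) (\<psi> l) \<longleftrightarrow> on_line p l" if pl: "p \<in> P" "l \<in> L" for p l
  proof
    assume m: "meets (\<phi> p) (\<psi> l)"
    show "on_line p l"
    proof (rule ccontr)
      assume "\<not> on_line p l"
      hence "(A p, B l) \<in> \<P>" using R[OF pl] pl by (simp add: \<P>_def)
      from apart[OF this \<phi> \<psi>] show False using m by simp
    qed
  next
    assume "on_line p l"
    hence "meets (A p) (B l)" using R[OF pl] by simp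
    thus "meets (\<phi> p) (\<psi> l)" using \<phi>[of p] \<psi>[of l] unfolding near_def by blast
  qed
  have disj: "\<phi> p \<noteq> \<psi> l" if pl: "p \<in> P" "l \<in> L" for p l
  proof
    assume eq: "\<phi> p = \<psi> l"
    have "u0 p \<in> \<phi> p" using \<phi>[of p] unfolding near_def A_def by auto
    then obtain y where y: "y \<in> B l" "dist (u0 p) y < \<epsilon> / 2"
      using \<psi>[of l] unfolding eq near_def by blast
    have "({u0 p}, B l) \<in> \<P>" using bottom pl by (simp add: \<P>_def)
    hence "\<epsilon> \<le> dist (u0 p) y" using \<epsilon>(2) y(1) by blast
    thus False using y(2) \<epsilon>(1) by linarith
  qed
  note result = spanners_require_3_incidences[where R = on_line and \<phi> = \<phi> and \<psi> = \<psi>,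
      OF fin ne dA' dB' disj R' K22_free_on_line]
  have "\<forall>T\<in>\<phi> ` P \<union> \<psi> ` L. tetrahedron T"
    using \<phi> \<psi> unfolding near_def by auto
  \<comment> \<open>All incidences must be kept here; the count is halved only to match the form
    shared with the 2-hop families.\<close>
  moreover have "spanners_require 3 (\<phi> ` P \<union> \<psi> ` L) ((card (incidences on_line P L) + 1) div 2)"
    by (rule spanners_require_antimono[OF result(2)]) simp_all
  ultimately show ?thesis using result(1) by blast
qed

section \<open>The lower bounds\<close>

text \<open>For \<open>D = 0\<close> the target \<open>n\<close> divided by
  \<open>ln n / ln (ln n)\<close> is eventually at most \<open>n\<close>, so a matching suffices.
  For larger \<open>D\<close> the integer power is an ordinary one and the digit construction
  applies.\<close>

lemma net_lower_bound:
  fixes Q :: "'a set set \<Rightarrow> bool"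
  assumes net: "\<And>n N. D \<ge> 1 \<Longrightarrow> box_incidences_realizable D n N \<Longrightarrow>
      \<exists>F. card F = n \<and> Q F \<and> spanners_require t F ((N + 1) div 2)"
    and matching: "\<And>n. \<exists>F. card F = n \<and> Q F \<and> spanners_require t F (n div 2)"
  shows "\<exists>f::nat \<Rightarrow> nat.
     (\<lambda>n. real (f n)) \<in> \<Omega>(\<lambda>n. real n * (ln (real n) / ln (ln (real n))) powi (int D - 1)) \<and>
     (\<forall>n\<ge>1. \<exists>F. card F = n \<and> Q F \<and> spanners_require t F (f n))"
proof -
  have ex: "\<exists>F. card F = n \<and> Q F" for n using matching by blast
  show ?thesis
  proof (cases "D = 0")
    case True
    have "\<forall>\<^sub>F n in sequentially. ln (real n) / ln (ln (real n)) \<ge> 1" by real_asymp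
    moreover have "\<forall>\<^sub>F n in sequentially. n \<ge> (2::nat)" by (rule eventually_ge_at_top)
    ultimately have "\<forall>\<^sub>F n in sequentially. \<exists>F m. card F = n \<and> Q F \<and> spanners_require t F m \<and>
      1 / 4 * \<bar>real n * (ln (real n) / ln (ln (real n))) powi (int D - 1)\<bar> \<le> real m"
    proof eventually_elim
      case (elim n)
      obtain F where F: "card F = n" "Q F" "spanners_require t F (n div 2)" using matching by blast
      define x where "x = ln (real n) / ln (ln (real n))"
      have "inverse x \<le> 1" "0 \<le> inverse x" using elim(1) by (simp_all add: x_def[symmetric] inverse_le_1_iff)
      hence "real n * inverse x \<le> real n * 1" by (intro mult_left_mono) auto
      hence "1 / 4 * \<bar>real n * x powi (int D - 1)\<bar> \<le> real n / 4"
        using \<open>0 \<le> inverse x\<close> by (simp add: True power_int_minus)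
      also have "\<dots> \<le> real (n div 2)" using elim(2) by linarith
      finally show ?case using F unfolding x_def by blast
    qed
    with ex show ?thesis by (intro Omega_realization[where c = "1/4"]) auto
  next
    case False
    hence D: "D \<ge> 1" by simp
    obtain c where c: "c > 0" and ev: "\<forall>\<^sub>F n in sequentially. \<exists>N. box_incidences_realizable D n N \<and>
      c * \<bar>real n * (ln (real n) / ln (ln (real n))) ^ (D - 1)\<bar> \<le> real N"
      using box_incidences_asymptotics[OF D] by blast
    have e: "x powi (int D - 1) = x ^ (D - 1)" for x :: real
      using D by (metis of_nat_1 of_nat_diff power_int_of_nat)
    from ev have "\<forall>\<^sub>F n in sequentially. \<exists>F m. card F = n \<and> Q F \<and> spanners_require t F m \<and>
      c / 2 * \<bar>real n * (ln (real n) / ln (ln (real n))) powi (int D - 1)\<bar> \<le> real m"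
    proof eventually_elim
      case (elim n)
      then obtain N where N: "box_incidences_realizable D n N"
        "c * \<bar>real n * (ln (real n) / ln (ln (real n))) ^ (D - 1)\<bar> \<le> real N" by blast
      obtain F where F: "card F = n" "Q F" "spanners_require t F ((N + 1) div 2)"
        using net[OF D N(1)] by blast
      have "real N / 2 \<le> real ((N + 1) div 2)" by linarith
      hence "c / 2 * \<bar>real n * (ln (real n) / ln (ln (real n))) powi (int D - 1)\<bar> \<le> real ((N + 1) div 2)"
        using N(2) unfolding e by linarith
      then show ?case using F by blast
    qed
    with ex c show ?thesis by (intro Omega_realization[where c = "c / 2"]) auto
  qed
qed

lemma box_lower_bound:
  "\<exists>f::nat \<Rightarrow> nat.
     (\<lambda>n. real (f n)) \<in> \<Omega>(\<lambda>n. real n * (ln (real n) / ln (ln (real n))) powi (int CARD('d) - 2)) \<and>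
     (\<forall>n\<ge>1. \<exists>F :: (real^'d) set set. card F = n \<and> (\<forall>B\<in>F. axis_aligned_box B) \<and> spanners_require 3 F (f n))"
proof -
  let ?D = "CARD('d) - 1"
  have card: "CARD('d) \<ge> 1" by (simp add: Suc_le_eq)
  have D: "int ?D - 1 = int CARD('d) - 2" using card by linarith
  show ?thesis
    unfolding D[symmetric]
  proof (rule net_lower_bound)
    fix n N assume "?D \<ge> 1" "box_incidences_realizable ?D n N"
    moreover have "CARD('d) = ?D + 1" using card by simp
    ultimately obtain F :: "(real^'d) set set" where
      F: "card F = n" "\<forall>B\<in>F. axis_aligned_box B" "spanners_require 3 F N"
      using exists_box_family by blast
    have "spanners_require 3 F ((N + 1) div 2)"
      by (rule spanners_require_antimono[OF F(3)]) simp_all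
    with F show "\<exists>F :: (real^'d) set set. card F = n \<and> (\<forall>B\<in>F. axis_aligned_box B) \<and> spanners_require 3 F ((N + 1) div 2)"
      by blast
  next
    fix n
    show "\<exists>F :: (real^'d) set set. card F = n \<and> (\<forall>B\<in>F. axis_aligned_box B) \<and> spanners_require 3 F (n div 2)"
      using exists_hypercube_matching[of n] axis_aligned_hypercube_imp_box by metis
  qed
qed

lemma hypercube_lower_bound:
  "\<exists>f::nat \<Rightarrow> nat.
     (\<lambda>n. real (f n)) \<in> \<Omega>(\<lambda>n. real n * (ln (real n) / ln (ln (real n))) powi (int (CARD('d) div 2) - 1)) \<and>
     (\<forall>n\<ge>1. \<exists>F :: (real^'d) set set. card F = n \<and>
        ((\<forall>Q\<in>F. axis_aligned_hypercube Q) \<and> pairwise congruent_sets F) \<and> spanners_require 2 F (f n))"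
proof (rule net_lower_bound)
  fix n N assume "CARD('d) div 2 \<ge> 1" "box_incidences_realizable (CARD('d) div 2) n N"
  then show "\<exists>F :: (real^'d) set set. card F = n \<and>
      ((\<forall>Q\<in>F. axis_aligned_hypercube Q) \<and> pairwise congruent_sets F) \<and> spanners_require 2 F ((N + 1) div 2)"
    unfolding conj_assoc by (intro exists_hypercube_family) simp_all
next
  fix n
  obtain F :: "(real^'d) set set" where F: "card F = n" "\<forall>Q\<in>F. axis_aligned_hypercube Q"
    "pairwise congruent_sets F" "spanners_require 3 F (n div 2)"
    using exists_hypercube_matching by blast
  have "spanners_require 2 F (n div 2)" by (rule spanners_require_antimono[OF F(4)]) simp_all
  with F show "\<exists>F :: (real^'d) set set. card F = n \<and>
      ((\<forall>Q\<in>F. axis_aligned_hypercube Q) \<and> pairwise congruent_sets F) \<and> spanners_require 2 F (n div 2)"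
    by blast
qed

theorem theorem5p4:
  shows
    "(\<exists>f::nat \<Rightarrow> nat. (\<lambda>n. real (f n)) \<in> \<Omega>(\<lambda>n. real n powr (4/3)) \<and>
        (\<forall>n\<ge>1. \<exists>F :: (real^3) set set.
           card F = n \<and> (\<forall>T\<in>F. tetrahedron T) \<and>
           spanners_require 3 F (f n)))
   \<and> (\<exists>f::nat \<Rightarrow> nat. (\<lambda>n. real (f n)) \<in> \<Omega>(\<lambda>n. real n powr (4/3)) \<and>
        (\<forall>n\<ge>1. \<exists>F :: (real^3) set set.
           card F = n \<and> (\<forall>T\<in>F. regular_tetrahedron T) \<and> pairwise congruent_sets F \<and>
           spanners_require 2 F (f n)))
   \<and> (\<exists>f::nat \<Rightarrow> nat. (\<lambda>n. real (f n)) \<in> \<Omega>(\<lambda>n. real n powr (4/3)) \<and>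
        (\<forall>n\<ge>1. \<exists>F :: (real^3) set set.
           card F = n \<and> (\<forall>Q\<in>F. hypercube Q \<and> \<not> axis_aligned_box Q) \<and>
           pairwise congruent_sets F \<and> spanners_require 2 F (f n)))
   \<and> (\<exists>f::nat \<Rightarrow> nat. (\<lambda>n. real (f n)) \<in> \<Omega>(\<lambda>n. real n powr (4/3)) \<and>
        (\<forall>n\<ge>1. \<exists>F :: (real^5) set set.
           card F = n \<and> (\<forall>B\<in>F. solid_ball B) \<and> pairwise congruent_sets F \<and>
           spanners_require 2 F (f n)))
   \<and> (\<exists>f::nat \<Rightarrow> nat.
        (\<lambda>n. real (f n)) \<in>
          \<Omega>(\<lambda>n. real n * (ln (real n) / ln (ln (real n))) powi (int CARD('d) - 2)) \<and>
        (\<forall>n\<ge>1. \<exists>F :: (real^'d) set set.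
           card F = n \<and> (\<forall>B\<in>F. axis_aligned_box B) \<and>
           spanners_require 3 F (f n)))
   \<and> (\<exists>f::nat \<Rightarrow> nat.
        (\<lambda>n. real (f n)) \<in>
          \<Omega>(\<lambda>n. real n * (ln (real n) / ln (ln (real n))) powi (int (CARD('d) div 2) - 1)) \<and>
        (\<forall>n\<ge>1. \<exists>F :: (real^'d) set set.
           card F = n \<and> (\<forall>Q\<in>F. axis_aligned_hypercube Q) \<and> pairwise congruent_sets F \<and>
           spanners_require 2 F (f n)))"
  by (intro conjI
      point_line_lower_bound[OF exists_tetrahedron_family]
      point_line_lower_bound[OF exists_regular_tetrahedron_family, unfolded conj_assoc]
      point_line_lower_bound[OF exists_hypercube_touching_family, unfolded conj_assoc]
      point_line_lower_bound[OF exists_ball_family, unfolded conj_assoc]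
      box_lower_bound hypercube_lower_bound[unfolded conj_assoc])

end
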